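(* Let $t(\alpha,u)=\alpha$ or $t(\alpha,u)=\alpha u$. Consider $K>K_{\mathrm{low}}$, $\alpha>0$ and $u>v$ (with $\alpha\le\bar\alpha$, $u\le\bar u$). If $g$ is such that $r(u)=\frac{1-G(u)}{g(u)}-u$ is decreasing, then every optimal solution $(a^\circ,c^\circ)$ of the relaxed regulator's problem (R) described in the context satisfies $$a^\circ(\alpha,u)=0\quad\text{and}\quad c^\circ(\alpha,u)=0.$$
   Context: Fix $\bar\alpha,\bar u>0$, $v>0$. The types $\alpha\in[0,\bar\alpha]$ and $u\in[0,\bar u]$ are independent with densities $f$ on $[0,\bar\alpha]$ and $g$ on $[0,\bar u]$, positive and continuous on these intervals (zero outside), with c.d.f.s $F$ and $G$. $\alpha^*(u):=\min\{\alpha>0:\min(t(\alpha,u),v)=u\}$, i.e. $\alpha^*(u)=u$ if $t(\alpha,u)=\alpha$ and $\alpha^*(u)=1$ if $t(\alpha,u)=\alpha u$, and $$K_{\mathrm{low}}:=\frac{\int_0^v(1-F(\alpha^*(u)))(1-G(u)-ug(u))\,du}{\int_0^v(1-F(\alpha^*(u)))g(u)\,du}.$$ Problem (R), with inspection cost $K$: over functions $a,c:[0,\bar\alpha]\times[0,\bar u]\to[0,1]$, maximize $$\int_0^{\bar u} g(u)\int_0^{\bar\alpha} f(\alpha)\big(\min(v,t(\alpha,u))-u\big)a(\alpha,u)\,d\alpha\,du$$ subject to (budget) $\int_0^{\bar u}g(u)\int_0^{\bar\alpha}f(\alpha)\Big(\int_0^u a(\alpha,x)\,dx-u\,a(\alpha,u)\Big)d\alpha\,du\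 \ge\ K\int_0^{\bar u}g(u)\int_0^{\bar\alpha}f(\alpha)c(\alpha,u)\,d\alpha\,du$; $a(\alpha,u)-a(\alpha,u)c(\alpha,u)\le a(0,u)$ for all $\alpha,u$; $c(\alpha,u)\le a(\alpha,u)$ for all $\alpha,u$; $a(\alpha,u)\le a(\alpha,u')$ for all $\alpha$ and all $u\ge u'$; $a(0,u)\le a(\alpha,u)$ for all $\alpha,u$.
   Formalization: The conclusion is proved for almost every α in (0,ᾱ] and every u in (v,ū], with a, c jointly Borel measurable; for every α it is false, since setting a=c=1 at a single α>0 leaves all constraints and integrals unchanged. *)

theory Defs
  imports "HOL-Probability.Probability"
begin

definition law :: "(real \<Rightarrow> real) \<Rightarrow> real measure" where
  "law f = density lborel (\<lambda>x. ennreal (f x))"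

definition type_density :: "real \<Rightarrow> (real \<Rightarrow> real) \<Rightarrow> bool" where
  "type_density b f \<longleftrightarrow>
     continuous_on {0..b} f \<and>
     (\<forall>x\<in>{0..b}. 0 < f x) \<and>
     (\<forall>x. x \<notin> {0..b} \<longrightarrow> f x = 0) \<and>
     prob_space (law f)"

text \<open>The value \<open>alpha_star t v 0\<close> is irrelevant: it enters \<open>K_low\<close> only through integrals over \<open>u\<close>.
  The minimum is over all positive reals, not only those in the support of \<open>\<alpha>\<close>.\<close>

definition alpha_star :: "(real \<Rightarrow> real \<Rightarrow> real) \<Rightarrow> real \<Rightarrow> real \<Rightarrow> real" where
  "alpha_star t v u = (LEAST \<alpha>. 0 < \<alpha> \<and> min (t \<alpha> u) v = u)"

lemma alpha_star_id:
  assumes "0 < u" "u \<le> v"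
  shows "alpha_star (\<lambda>\<alpha> u. \<alpha>) v u = u"
  unfolding alpha_star_def using assms by (intro Least_equality) auto

lemma alpha_star_mult:
  assumes "0 < u" "u \<le> v"
  shows "alpha_star (\<lambda>\<alpha> u. \<alpha> * u) v u = 1"
  unfolding alpha_star_def
proof (intro Least_equality)
  show "0 < (1::real) \<and> min (1 * u) v = u" using assms by auto
next
  fix \<alpha> :: real
  assume "0 < \<alpha> \<and> min (\<alpha> * u) v = u"
  then have "1 * u \<le> \<alpha> * u" by linarith
  then show "1 \<le> \<alpha>" using assms(1) by (simp only: mult_le_cancel_right)
qed

definition K_low ::
  "(real \<Rightarrow> real) \<Rightarrow> (real \<Rightarrow> real) \<Rightarrow> (real \<Rightarrow> real \<Rightarrow> real) \<Rightarrow> real \<Rightarrow> real" where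
  "K_low f g t v =
     (LBINT u:{0..v}. (1 - cdf (law f) (alpha_star t v u)) * (1 - cdf (law g) u - u * g u)) /
     (LBINT u:{0..v}. (1 - cdf (law f) (alpha_star t v u)) * g u)"

definition virtual_surplus :: "(real \<Rightarrow> real) \<Rightarrow> real \<Rightarrow> real" where
  "virtual_surplus g u = (1 - cdf (law g) u) / g u - u"

definition welfare ::
  "real \<Rightarrow> real \<Rightarrow> (real \<Rightarrow> real) \<Rightarrow> (real \<Rightarrow> real) \<Rightarrow> (real \<Rightarrow> real \<Rightarrow> real) \<Rightarrow> real
    \<Rightarrow> (real \<Rightarrow> real \<Rightarrow> real) \<Rightarrow> real" where
  "welfare abar ubar f g t v a =
     (LBINT u:{0..ubar}. g u * (LBINT \<alpha>:{0..abar}. f \<alpha> * ((min v (t \<alpha> u) - u) * a \<alpha> u)))"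

definition revenue ::
  "real \<Rightarrow> real \<Rightarrow> (real \<Rightarrow> real) \<Rightarrow> (real \<Rightarrow> real) \<Rightarrow> (real \<Rightarrow> real \<Rightarrow> real) \<Rightarrow> real" where
  "revenue abar ubar f g a =
     (LBINT u:{0..ubar}. g u *
        (LBINT \<alpha>:{0..abar}. f \<alpha> * ((LBINT x:{0..u}. a \<alpha> x) - u * a \<alpha> u)))"

definition inspections ::
  "real \<Rightarrow> real \<Rightarrow> (real \<Rightarrow> real) \<Rightarrow> (real \<Rightarrow> real) \<Rightarrow> (real \<Rightarrow> real \<Rightarrow> real) \<Rightarrow> real" where
  "inspections abar ubar f g c =
     (LBINT u:{0..ubar}. g u * (LBINT \<alpha>:{0..abar}. f \<alpha> * c \<alpha> u))"

text \<open>Joint Borel measurability is what gives the integrals in the objective and in the budget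
  constraint their meaning; the integral of a non-integrable function is \<open>0\<close> by convention.\<close>

definition feasible ::
  "real \<Rightarrow> real \<Rightarrow> (real \<Rightarrow> real) \<Rightarrow> (real \<Rightarrow> real) \<Rightarrow> real
    \<Rightarrow> (real \<Rightarrow> real \<Rightarrow> real) \<Rightarrow> (real \<Rightarrow> real \<Rightarrow> real) \<Rightarrow> bool" where
  "feasible abar ubar f g K a c \<longleftrightarrow>
     set_borel_measurable borel ({0..abar} \<times> {0..ubar}) (\<lambda>(\<alpha>, u). a \<alpha> u) \<and>
     set_borel_measurable borel ({0..abar} \<times> {0..ubar}) (\<lambda>(\<alpha>, u). c \<alpha> u) \<and>
     (\<forall>\<alpha>\<in>{0..abar}. \<forall>u\<in>{0..ubar}. a \<alpha> u \<in> {0..1} \<and> c \<alpha> u \<in> {0..1}) \<and>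
     revenue abar ubar f g a \<ge> K * inspections abar ubar f g c \<and>
     (\<forall>\<alpha>\<in>{0..abar}. \<forall>u\<in>{0..ubar}. a \<alpha> u - a \<alpha> u * c \<alpha> u \<le> a 0 u) \<and>
     (\<forall>\<alpha>\<in>{0..abar}. \<forall>u\<in>{0..ubar}. c \<alpha> u \<le> a \<alpha> u) \<and>
     (\<forall>\<alpha>\<in>{0..abar}. \<forall>u\<in>{0..ubar}. \<forall>u'\<in>{0..ubar}. u' \<le> u \<longrightarrow> a \<alpha> u \<le> a \<alpha> u') \<and>
     (\<forall>\<alpha>\<in>{0..abar}. \<forall>u\<in>{0..ubar}. a 0 u \<le> a \<alpha> u)"

text \<open>For a single \<open>\<alpha> > 0\<close>, replacing \<open>a \<alpha>\<close> and \<open>c \<alpha>\<close> by the constant \<open>1\<close> preserves optimality, so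
  solutions are determined only up to a null set of \<open>\<alpha>\<close>.\<close>

definition optimal ::
  "real \<Rightarrow> real \<Rightarrow> (real \<Rightarrow> real) \<Rightarrow> (real \<Rightarrow> real) \<Rightarrow> (real \<Rightarrow> real \<Rightarrow> real) \<Rightarrow> real \<Rightarrow> real
    \<Rightarrow> (real \<Rightarrow> real \<Rightarrow> real) \<Rightarrow> (real \<Rightarrow> real \<Rightarrow> real) \<Rightarrow> bool" where
  "optimal abar ubar f g t v K a c \<longleftrightarrow>
     feasible abar ubar f g K a c \<and>
     (\<forall>a' c'. feasible abar ubar f g K a' c' \<longrightarrow>
        welfare abar ubar f g t v a' \<le> welfare abar ubar f g t v a)"

end

theory Submission
  imports Defs
begin

text \<open>Fubini turns revenue into the expectation of \<open>r a\<close>, \<open>r\<close> the virtual surplus. As this is nonnegative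
  for every \<open>a\<close> decreasing in \<open>u\<close> and \<open>r\<close> is decreasing, \<open>K_low\<close> is at least \<open>0\<close> and (outside a degenerate
  case) at least \<open>r v\<close>. Now cut an optimal solution off above \<open>v\<close>. This raises welfare, so if the solution
  was positive there, the cut must violate the budget, which forces \<open>r v > 0\<close>. Restore the budget by mixing
  with the posted price \<open>v\<close> (everybody with \<open>u \<le> v\<close> is served without inspection). Let \<open>D\<close> be the expected
  value of \<open>v - min v (t \<alpha> v)\<close>. The Lagrangian with multiplier \<open>D / r v\<close> strictly increases under the cut
  and is maximized by the posted price, because \<open>c \<ge> a - a 0\<close> and \<open>K \<ge> r v\<close>; so the mixture, whose budget is
  exactly balanced, has strictly higher welfare.\<close>

text \<open>A nonempty open interval is not a null set. This turns almost-everywhere statements into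
  statements about an actual point.\<close>

lemma AE_interval_witness:
  fixes l h :: real
  assumes "AE x in lborel. l < x \<and> x < h \<longrightarrow> P x" and "l < h"
  obtains x where "l < x" "x < h" "P x"
proof -
  have "\<exists>x\<in>{l<..<h}. P x"
  proof (rule ccontr)
    assume "\<not> ?thesis"
    then have "AE x in lborel. x \<notin> {l<..<h}"
      using assms(1) by (auto elim!: eventually_mono)
    then have "emeasure lborel {l<..<h} = 0"
      by (subst (asm) AE_iff_measurable[where N = "{l<..<h}"]) auto
    then show False using assms(2) by simp
  qed
  then show ?thesis using that by auto
qed

subsection \<open>The law of a type\<close>

locale type_law =
  fixes b :: real and f :: "real \<Rightarrow> real"
  assumes b_pos: "0 < b" and type_density: "type_density b f"
begin

sublocale prob_space "law f"
  using type_density by (simp add: type_density_def)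

lemma density_pos: "x \<in> {0..b} \<Longrightarrow> 0 < f x"
  and density_zero: "x \<notin> {0..b} \<Longrightarrow> f x = 0"
  using type_density by (auto simp: type_density_def)

lemma density_nonneg: "0 \<le> f x"
  using density_pos[of x] density_zero[of x] by (cases "x \<in> {0..b}") auto

lemma density_measurable [measurable]: "f \<in> borel_measurable borel"
proof -
  have "(\<lambda>x. indicator {0..b} x *\<^sub>R f x) \<in> borel_measurable borel"
    using type_density
    by (intro borel_measurable_continuous_on_indicator) (auto simp: type_density_def)
  also have "(\<lambda>x. indicator {0..b} x *\<^sub>R f x) = f"
    using density_zero by (fastforce simp: fun_eq_iff indicator_def)
  finally show ?thesis .
qed

lemma sets_law [measurable_cong, simp]: "sets (law f) = sets borel"
  by (simp add: law_def)

lemma space_law [simp]: "space (law f) = UNIV"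
  by (simp add: law_def)

text \<open>The density is positive exactly on \<open>{0..b}\<close>, so the law and Lebesgue
  measure have the same null sets there.\<close>

lemma AE_law_iff: "(AE x in law f. P x) \<longleftrightarrow> (AE x in lborel. x \<in> {0..b} \<longrightarrow> P x)"
proof -
  have "0 < f x \<longleftrightarrow> x \<in> {0..b}" for x
    using density_pos[of x] density_zero[of x] by (cases "x \<in> {0..b}") auto
  then show ?thesis
    unfolding law_def by (subst AE_density) auto
qed

lemma AE_law_range: "AE x in law f. x \<in> {0..b}"
  by (simp add: AE_law_iff)

lemma integral_law:
  assumes [measurable]: "h \<in> borel_measurable borel"
  shows "(\<integral>x. h x \<partial>law f) = (\<integral>x. f x * h x \<partial>lborel)"
  unfolding law_def using density_nonneg by (subst integral_density) auto

text \<open>Measurability is assumed only for the restriction of \<open>h\<close>, since feasible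
  mechanisms are arbitrary outside the rectangle of types.\<close>

lemma integral_law_interval:
  fixes h :: "real \<Rightarrow> real"
  assumes [measurable]: "(\<lambda>x. indicator {0..b} x * h x) \<in> borel_measurable borel"
  shows "(LBINT x:{0..b}. f x * h x) = (\<integral>x. indicator {0..b} x * h x \<partial>law f)"
proof -
  have "(\<integral>x. indicator {0..b} x * h x \<partial>law f)
      = (\<integral>x. f x * (indicator {0..b} x * h x) \<partial>lborel)"
    by (rule integral_law) (rule assms)
  then show ?thesis
    by (simp add: set_lebesgue_integral_def mult_ac)
qed

text \<open>A positive density gives mass to every interval inside the support, so none can be left
  between \<open>y\<close> and \<open>b\<close>. The lower end \<open>max 0 y\<close> keeps the test
  interval inside the support.\<close>

lemma cdf_law_eq_1_imp:
  assumes "cdf (law f) y = 1"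
  shows "b \<le> y"
proof (rule ccontr)
  assume "\<not> b \<le> y"
  have "AE x in law f. x \<in> {..y}"
    using assms by (subst AE_in_set_eq_1) (auto simp: cdf_def)
  then have "AE x in lborel. max 0 y < x \<and> x < b \<longrightarrow> x \<le> y"
    unfolding AE_law_iff by (auto elim!: eventually_mono)
  then show False
    using \<open>\<not> b \<le> y\<close> b_pos by (rule_tac AE_interval_witness[of "max 0 y" b "\<lambda>x. x \<le> y"]) auto
qed

lemma prob_atLeast: "prob {x..} = 1 - cdf (law f) x"
proof -
  have "AE y in law f. y \<noteq> x"
    unfolding AE_law_iff using AE_lborel_singleton[of x] by (auto elim!: eventually_mono)
  then have "prob {x..} = prob {x<..}"
    by (intro finite_measure_eq_AE) (auto elim!: eventually_mono)
  also have "{x<..} = UNIV - {..x}" by auto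
  finally show ?thesis
    using prob_compl[of "{..x}"] by (simp add: cdf_def)
qed

lemma cdf_law_bounds: "0 \<le> cdf (law f) x" "cdf (law f) x \<le> 1"
  by (auto simp: cdf_def)

lemma cdf_law_mono: "x \<le> y \<Longrightarrow> cdf (law f) x \<le> cdf (law f) y"
  unfolding cdf_def by (intro finite_measure_mono) auto

lemma cdf_law_measurable [measurable]: "cdf (law f) \<in> borel_measurable borel"
  by (intro borel_measurable_mono monoI cdf_law_mono)

lemma virtual_surplus_measurable [measurable]: "virtual_surplus f \<in> borel_measurable borel"
  unfolding virtual_surplus_def[abs_def] by measurable

lemma density_times_virtual_surplus:
  assumes "x \<in> {0..b}"
  shows "f x * virtual_surplus f x = 1 - cdf (law f) x - x * f x"
  using density_pos[OF assms] by (simp add: virtual_surplus_def field_simps)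

text \<open>The integration by parts behind the virtual surplus, as a Fubini swap.\<close>

lemma integral_law_tail:
  fixes h :: "real \<Rightarrow> real"
  assumes [measurable]: "h \<in> borel_measurable borel"
    and bound: "\<And>x. \<bar>h x\<bar> \<le> 1" and zero: "\<And>x. x \<notin> {0..b} \<Longrightarrow> h x = 0"
  shows "(\<integral>u. (LBINT x:{0..u}. h x) \<partial>law f)
       = (\<integral>x. (1 - cdf (law f) x) / f x * h x \<partial>law f)"
proof -
  interpret pair_sigma_finite "law f" lborel
    by unfold_locales
  let ?k = "\<lambda>u x. indicator {0..u} x * h x"
  have "integrable (law f \<Otimes>\<^sub>M lborel) (case_prod ?k)"
  \<comment> \<open>The kernel is dominated by the indicator of a strip of finite measure, because
    \<open>h\<close> vanishes outside \<open>{0..b}\<close>.\<close>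
  proof (rule Bochner_Integration.integrable_bound)
    have "emeasure (law f \<Otimes>\<^sub>M lborel) (UNIV \<times> {0..b}) < \<infinity>"
      using emeasure_space_1 b_pos
      by (subst lborel.emeasure_pair_measure_Times) auto
    then show "integrable (law f \<Otimes>\<^sub>M lborel) (indicator (UNIV \<times> {0..b}) :: _ \<Rightarrow> real)"
      by (intro integrable_real_indicator) auto
    show "case_prod ?k \<in> borel_measurable (law f \<Otimes>\<^sub>M lborel)"
    proof -
      have eq: "case_prod ?k = (\<lambda>z. if 0 \<le> snd z \<and> snd z \<le> fst z then h (snd z) else 0)"
        by (auto simp: fun_eq_iff indicator_def)
      have "case_prod ?k \<in> borel_measurable (borel \<Otimes>\<^sub>M borel)"
        unfolding eq by measurable
      then show ?thesis
        by (simp cong: measurable_cong_sets sets_pair_measure_cong)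
    qed
    show "AE z in law f \<Otimes>\<^sub>M lborel. norm (case z of (u, x) \<Rightarrow> ?k u x)
        \<le> norm (indicator (UNIV \<times> {0..b}) z :: real)"
    proof (intro AE_I2)
      fix z :: "real \<times> real"
      show "norm (case z of (u, x) \<Rightarrow> ?k u x) \<le> norm (indicator (UNIV \<times> {0..b}) z :: real)"
        using bound[of "snd z"] zero[of "snd z"]
        by (cases "snd z \<in> {0..b}") (auto simp: indicator_def split: prod.splits)
    qed
  qed
  then have "(\<integral>u. (\<integral>x. ?k u x \<partial>lborel) \<partial>law f) = (\<integral>x. (\<integral>u. ?k u x \<partial>law f) \<partial>lborel)"
    by (rule Fubini_integral[symmetric])
  also have "\<dots> = (\<integral>x. f x * ((1 - cdf (law f) x) / f x * h x) \<partial>lborel)"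
  proof (rule Bochner_Integration.integral_cong)
    fix x :: real
    show "(\<integral>u. ?k u x \<partial>law f) = f x * ((1 - cdf (law f) x) / f x * h x)"
    proof (cases "x \<in> {0..b}")
      case True
      \<comment> \<open>With \<open>x\<close> fixed, the condition \<open>x \<le> u\<close> leaves
        the tail \<open>{x..}\<close> in \<open>u\<close>; its probability becomes the numerator of
        the inverse hazard rate.\<close>
      then have "(\<lambda>u. ?k u x) = (\<lambda>u. indicator {x..} u * h x)"
        by (auto simp: indicator_def)
      then have "(\<integral>u. ?k u x \<partial>law f) = prob {x..} * h x"
        by simp
      then show ?thesis
        using density_pos[OF True] by (simp add: prob_atLeast)
    qed (simp add: zero)
  qed simp
  also have "\<dots> = (\<integral>x. (1 - cdf (law f) x) / f x * h x \<partial>law f)"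
    by (subst integral_law) auto
  finally show ?thesis
    by (simp add: set_lebesgue_integral_def)
qed

end

subsection \<open>The joint law on the rectangle of types\<close>

locale independent_types = A: type_law abar f + U: type_law ubar g for abar ubar f g
begin

sublocale pair_prob_space "law f" "law g" ..

definition rect :: "(real \<times> real) set" where "rect = {0..abar} \<times> {0..ubar}"

text \<open>Restriction to the rectangle makes measurability under \<open>joint\<close> match the
  \<open>set_borel_measurable\<close> conditions of \<open>feasible\<close>, which say nothing about
  values elsewhere.\<close>

definition joint :: "(real \<times> real) measure" where
  "joint = restrict_space (law f \<Otimes>\<^sub>M law g) rect"

lemma mem_rect: "(x, y) \<in> rect \<longleftrightarrow> 0 \<le> x \<and> x \<le> abar \<and> 0 \<le> y \<and> y \<le> ubar"
  by (auto simp: rect_def)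

lemma sets_product: "sets (law f \<Otimes>\<^sub>M law g) = sets (borel \<Otimes>\<^sub>M borel)"
  by (rule sets_pair_measure_cong) simp_all

lemma rect_sets [measurable]: "rect \<in> sets (borel \<Otimes>\<^sub>M borel)"
  by (simp add: rect_def)

lemma rect_sets_product [simp]: "rect \<inter> space (law f \<Otimes>\<^sub>M law g) \<in> sets (law f \<Otimes>\<^sub>M law g)"
  using rect_sets by (simp add: sets_product space_pair_measure)

lemma space_joint [simp]: "space joint = rect"
  by (simp add: joint_def space_restrict_space space_pair_measure)

lemma joint_measurable_iff:
  fixes \<phi> :: "real \<times> real \<Rightarrow> real"
  shows "\<phi> \<in> borel_measurable joint \<longleftrightarrow>
    (\<lambda>z. indicator rect z * \<phi> z) \<in> borel_measurable (borel \<Otimes>\<^sub>M borel)"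
  unfolding joint_def
  by (subst borel_measurable_restrict_space_iff)
     (simp_all add: mult.commute cong: measurable_cong_sets[OF sets_product refl])

lemma joint_measurable [measurable (raw)]:
  fixes \<phi> :: "real \<times> real \<Rightarrow> real"
  assumes [measurable]: "\<phi> \<in> borel_measurable (borel \<Otimes>\<^sub>M borel)"
  shows "\<phi> \<in> borel_measurable joint"
  unfolding joint_measurable_iff by measurable

lemma fst_joint [measurable]: "fst \<in> joint \<rightarrow>\<^sub>M borel"
  and snd_joint [measurable]: "snd \<in> joint \<rightarrow>\<^sub>M borel"
  by (auto intro: joint_measurable)

sublocale joint: finite_measure joint
  unfolding joint_def by (rule finite_measure_restrict_space) (auto intro: P.finite_measure_axioms)

lemma integrable_joint:
  fixes \<phi> :: "real \<times> real \<Rightarrow> real"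
  assumes "\<phi> \<in> borel_measurable joint" and "\<And>x y. (x, y) \<in> rect \<Longrightarrow> \<bar>\<phi> (x, y)\<bar> \<le> C"
  shows "integrable joint \<phi>"
  by (rule joint.integrable_const_bound[where B = C]) (use assms in \<open>auto intro!: AE_I2\<close>)

lemma integral_joint_iterated:
  fixes \<phi> :: "real \<times> real \<Rightarrow> real"
  assumes meas: "\<phi> \<in> borel_measurable joint"
    and bound: "\<And>x y. (x, y) \<in> rect \<Longrightarrow> \<bar>\<phi> (x, y)\<bar> \<le> C"
  shows "(\<integral>z. \<phi> z \<partial>joint) = (\<integral>y. (\<integral>x. indicator rect (x, y) * \<phi> (x, y) \<partial>law f) \<partial>law g)"
    and "(\<integral>z. \<phi> z \<partial>joint) = (\<integral>x. (\<integral>y. indicator rect (x, y) * \<phi> (x, y) \<partial>law g) \<partial>law f)"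
proof -
  let ?\<psi> = "\<lambda>z. indicator rect z * \<phi> z"
  have "integrable (law f \<Otimes>\<^sub>M law g) ?\<psi>"
    using integrable_joint[OF meas bound]
    by (simp add: joint_def integrable_restrict_space)
  then have int: "integrable (law f \<Otimes>\<^sub>M law g) (case_prod (\<lambda>x y. ?\<psi> (x, y)))"
    by (simp add: split_beta')
  have "(\<integral>z. \<phi> z \<partial>joint) = (\<integral>z. ?\<psi> z \<partial>(law f \<Otimes>\<^sub>M law g))"
    by (simp add: joint_def integral_restrict_space)
  then show "(\<integral>z. \<phi> z \<partial>joint) = (\<integral>y. (\<integral>x. ?\<psi> (x, y) \<partial>law f) \<partial>law g)"
    and "(\<integral>z. \<phi> z \<partial>joint) = (\<integral>x. (\<integral>y. ?\<psi> (x, y) \<partial>law g) \<partial>law f)"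
    using integral_snd[OF int] integral_fst[OF int] by (simp_all add: split_beta')
qed

lemma section_measurable:
  fixes \<phi> :: "real \<times> real \<Rightarrow> real"
  assumes "\<phi> \<in> borel_measurable joint"
  shows "(\<lambda>x. indicator rect (x, y) * \<phi> (x, y)) \<in> borel_measurable borel"
    and "(\<lambda>y. indicator rect (x, y) * \<phi> (x, y)) \<in> borel_measurable borel"
proof -
  have "(\<lambda>z. indicator rect z * \<phi> z) \<in> borel_measurable (borel \<Otimes>\<^sub>M borel)"
    using assms by (simp add: joint_measurable_iff)
  from measurable_compose[OF _ this, of "\<lambda>x. (x, y)" borel]
    measurable_compose[OF _ this, of "\<lambda>y. (x, y)" borel]
  show "(\<lambda>x. indicator rect (x, y) * \<phi> (x, y)) \<in> borel_measurable borel"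
    and "(\<lambda>y. indicator rect (x, y) * \<phi> (x, y)) \<in> borel_measurable borel"
    by simp_all
qed

text \<open>Bridge from the nested Lebesgue integrals in \<open>welfare\<close>,
  \<open>revenue\<close> and \<open>inspections\<close> to expectations under one finite measure,
  where linearity and pointwise comparison are available.\<close>

lemma LBINT_eq_integral_joint:
  fixes \<phi> :: "real \<times> real \<Rightarrow> real"
  assumes meas: "\<phi> \<in> borel_measurable joint"
    and bound: "\<And>x y. (x, y) \<in> rect \<Longrightarrow> \<bar>\<phi> (x, y)\<bar> \<le> C"
  shows "(LBINT y:{0..ubar}. g y * (LBINT x:{0..abar}. f x * \<phi> (x, y))) = (\<integral>z. \<phi> z \<partial>joint)"
proof -
  have ind: "indicator rect (x, y) = indicator {0..abar} x * (indicator {0..ubar} y :: real)" for x y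
    by (simp add: rect_def indicator_times)
  have inner: "(LBINT x:{0..abar}. f x * \<phi> (x, y)) = (\<integral>x. indicator {0..abar} x * \<phi> (x, y) \<partial>law f)"
    if "y \<in> {0..ubar}" for y
    using section_measurable(1)[OF meas, of y] that
    by (intro A.integral_law_interval) (simp add: ind)
  have eq: "(\<integral>x. indicator rect (x, y) * \<phi> (x, y) \<partial>law f)
      = indicator {0..ubar} y * (LBINT x:{0..abar}. f x * \<phi> (x, y))" for y
    by (cases "y \<in> {0..ubar}") (auto simp: ind inner)
  have "(\<lambda>y. \<integral>x. indicator rect (x, y) * \<phi> (x, y) \<partial>law f) \<in> borel_measurable borel"
  proof (rule A.borel_measurable_lebesgue_integral)
    have "(\<lambda>z. indicator rect z * \<phi> z) \<in> borel_measurable (borel \<Otimes>\<^sub>M borel)"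
      using meas by (simp add: joint_measurable_iff)
    from measurable_compose[OF measurable_pair_swap' this]
    have "(\<lambda>(y, x). indicator rect (x, y) * \<phi> (x, y)) \<in> borel_measurable (borel \<Otimes>\<^sub>M borel)"
      by (simp add: split_beta')
    then show "(\<lambda>(y, x). indicator rect (x, y) * \<phi> (x, y)) \<in> borel_measurable (borel \<Otimes>\<^sub>M law f)"
      by (simp cong: measurable_cong_sets sets_pair_measure_cong)
  qed
  then have "(LBINT y:{0..ubar}. g y * (LBINT x:{0..abar}. f x * \<phi> (x, y)))
      = (\<integral>y. indicator {0..ubar} y * (LBINT x:{0..abar}. f x * \<phi> (x, y)) \<partial>law g)"
    by (intro U.integral_law_interval) (simp add: eq)
  then show ?thesis
    by (simp add: integral_joint_iterated(1)[OF assms] eq)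
qed

text \<open>By independence, a centred function of the first coordinate is uncorrelated with every
  bounded function of the second.\<close>

lemma integral_joint_centred:
  fixes d \<phi> :: "real \<Rightarrow> real"
  assumes [measurable]: "d \<in> borel_measurable borel"
    and \<phi>: "(\<lambda>(x, y). \<phi> y) \<in> borel_measurable joint"
    and d_bound: "\<And>x. x \<in> {0..abar} \<Longrightarrow> \<bar>d x\<bar> \<le> C"
    and \<phi>_bound: "\<And>y. y \<in> {0..ubar} \<Longrightarrow> \<bar>\<phi> y\<bar> \<le> C'"
  shows "(\<integral>(x, y). ((\<integral>x. d x \<partial>law f) - d x) * \<phi> y \<partial>joint) = 0"
proof -
  let ?D = "\<integral>x. d x \<partial>law f"
  have int_d: "integrable (law f) d"
    by (rule A.integrable_const_bound[where B = C], rule eventually_mono[OF A.AE_law_range])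
       (simp_all add: d_bound)
  have zero: "(\<integral>x. indicator rect (x, y) * ((?D - d x) * \<phi> y) \<partial>law f) = 0" for y
  proof (cases "y \<in> {0..ubar}")
    case True
    have "(\<integral>x. indicator rect (x, y) * ((?D - d x) * \<phi> y) \<partial>law f) = (\<integral>x. (?D - d x) * \<phi> y \<partial>law f)"
      using True
      by (intro integral_cong_AE eventually_mono[OF A.AE_law_range])
         (auto simp: rect_def indicator_times)
    also have "\<dots> = (\<integral>x. ?D - d x \<partial>law f) * \<phi> y"
      by simp
    also have "\<dots> = 0"
      using int_d by (subst Bochner_Integration.integral_diff) (auto simp: A.prob_space[simplified])
    finally show ?thesis .
  qed (simp add: rect_def indicator_times)
  have "\<bar>(?D - d x) * \<phi> y\<bar> \<le> (\<bar>?D\<bar> + C) * C'" if "(x, y) \<in> rect" for x y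
  proof -
    have "\<bar>?D - d x\<bar> \<le> \<bar>?D\<bar> + C"
      using d_bound[of x] that by (auto simp: mem_rect)
    then show ?thesis
      using \<phi>_bound[of y] that unfolding abs_mult by (intro mult_mono) (auto simp: mem_rect)
  qed
  moreover have "(\<lambda>z. (?D - d (fst z)) * \<phi> (snd z)) \<in> borel_measurable joint"
    using \<phi> by (intro borel_measurable_times) (auto simp: split_beta')
  ultimately show ?thesis
    using integral_joint_iterated(1)[of "\<lambda>(x, y). (?D - d x) * \<phi> y" "(\<bar>?D\<bar> + C) * C'"] zero
    by (simp add: split_beta')
qed

text \<open>Fubini for null sets with \<alpha> outermost: for almost every \<alpha>, only a null set
  of \<open>u\<close> stays exceptional, and monotonicity in \<open>u\<close> can later repair
  that.\<close>

lemma AE_joint_imp: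
  assumes "AE z in joint. v < snd z \<longrightarrow> a (fst z) (snd z) = 0"
  shows "AE x in lborel. x \<in> {0..abar} \<longrightarrow> (AE y in lborel. v < y \<and> y \<in> {0..ubar} \<longrightarrow> a x y = (0::real))"
proof -
  have "AE z in law f \<Otimes>\<^sub>M law g. z \<in> rect \<longrightarrow> v < snd z \<longrightarrow> a (fst z) (snd z) = 0"
    using assms unfolding joint_def by (subst (asm) AE_restrict_space_iff[OF rect_sets_product])
  from AE_pair[OF this]
  have "AE x in lborel. x \<in> {0..abar} \<longrightarrow> (AE y in lborel. y \<in> {0..ubar} \<longrightarrow>
      (x, y) \<in> rect \<longrightarrow> v < y \<longrightarrow> a x y = 0)"
    by (simp add: A.AE_law_iff U.AE_law_iff)
  then show ?thesis
    by (auto elim!: eventually_mono simp: rect_def)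
qed

end

subsection \<open>Virtual surplus, revenue and \<open>K_low\<close>\<close>

locale regular_types = independent_types +
  assumes antimono: "antimono_on {0..ubar} (virtual_surplus g)"
begin

abbreviation r :: "real \<Rightarrow> real" where "r \<equiv> virtual_surplus g"

lemma r_mono: "0 \<le> x \<Longrightarrow> x \<le> y \<Longrightarrow> y \<le> ubar \<Longrightarrow> r y \<le> r x"
  using antimono by (auto simp: monotone_on_def)

definition r_bound :: real where "r_bound = \<bar>r 0\<bar> + \<bar>r ubar\<bar>"

lemma r_bound: "0 \<le> y \<Longrightarrow> y \<le> ubar \<Longrightarrow> \<bar>r y\<bar> \<le> r_bound"
  using r_mono[of 0 y] r_mono[of y ubar] by (auto simp: r_bound_def)

definition is_allocation :: "(real \<Rightarrow> real \<Rightarrow> real) \<Rightarrow> bool" where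
  "is_allocation a \<longleftrightarrow> (\<lambda>z. a (fst z) (snd z)) \<in> borel_measurable joint \<and>
     (\<forall>x y. (x, y) \<in> rect \<longrightarrow> 0 \<le> a x y \<and> a x y \<le> 1)"

lemma
  assumes a: "is_allocation a"
  shows integrable_allocation: "integrable joint (\<lambda>z. a (fst z) (snd z))"
    and integrable_r_allocation: "integrable joint (\<lambda>z. r (snd z) * a (fst z) (snd z))"
proof -
  have [measurable]: "(\<lambda>z. a (fst z) (snd z)) \<in> borel_measurable joint"
    and bound: "(x, y) \<in> rect \<Longrightarrow> \<bar>a x y\<bar> \<le> 1" for x y
    using a by (auto simp: is_allocation_def)
  show "integrable joint (\<lambda>z. a (fst z) (snd z))"
    using bound by (intro integrable_joint[where C = 1]) auto
  have "\<bar>r y * a x y\<bar> \<le> r_bound * 1" if "(x, y) \<in> rect" for x y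
    unfolding abs_mult using that bound[OF that] r_bound[of y]
    by (intro mult_mono) (auto simp: mem_rect r_bound_def)
  then show "integrable joint (\<lambda>z. r (snd z) * a (fst z) (snd z))"
    by (intro integrable_joint[where C = "r_bound * 1"]) auto
qed

section \<open>Revenue as expected virtual surplus\<close>

lemma inspections_eq:
  assumes "is_allocation c"
  shows "inspections abar ubar f g c = (\<integral>z. c (fst z) (snd z) \<partial>joint)"
  using LBINT_eq_integral_joint[of "\<lambda>z. c (fst z) (snd z)" 1] assms
  by (simp add: inspections_def is_allocation_def)

text \<open>For the equation, integrate over \<open>u\<close> first: for each fixed \<alpha>,
  \<open>integral_law_tail\<close> replaces the rent \<open>J\<close> by the inverse hazard rate
  times \<open>a\<close>. For nonnegativity, an allocation decreasing in \<open>u\<close> is at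
  least \<open>a x y\<close> on all of \<open>{0..y}\<close>, so \<open>J x y\<close> is at least
  \<open>y * a x y\<close>.\<close>

lemma
  assumes a: "is_allocation a"
  shows revenue_eq: "revenue abar ubar f g a = (\<integral>z. r (snd z) * a (fst z) (snd z) \<partial>joint)"
    and revenue_nonneg: "(\<And>x y y'. (x, y) \<in> rect \<Longrightarrow> 0 \<le> y' \<Longrightarrow> y' \<le> y \<Longrightarrow> a x y \<le> a x y') \<Longrightarrow>
      0 \<le> (\<integral>z. r (snd z) * a (fst z) (snd z) \<partial>joint)"
proof -
  have meas [measurable]: "(\<lambda>z. a (fst z) (snd z)) \<in> borel_measurable joint"
    and bound: "\<And>x y. (x, y) \<in> rect \<Longrightarrow> 0 \<le> a x y \<and> a x y \<le> 1"
    using a by (auto simp: is_allocation_def)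
  \<comment> \<open>Extension of \<open>a\<close> by zero: it is Borel and bounded on the whole
    plane, so its sections can be integrated without tracking the rectangle.\<close>
  define b where "b x y = indicator rect (x, y) * a x y" for x y
  have b_meas [measurable]: "(\<lambda>z. b (fst z) (snd z)) \<in> borel_measurable (borel \<Otimes>\<^sub>M borel)"
    using meas by (simp add: joint_measurable_iff b_def)
  have b_section [measurable]: "b x \<in> borel_measurable borel" for x
    using section_measurable(2)[OF meas, of x] by (simp add: b_def[abs_def])
  have b_bound: "0 \<le> b x y" "b x y \<le> 1" for x y
    using bound by (auto simp: b_def indicator_def)
  have b_eq: "b x y = a x y" if "(x, y) \<in> rect" for x y
    using that by (simp add: b_def)
  define J where "J x y = (LBINT s:{0..y}. a x s)" for x y
  have J_eq: "J x y = (LBINT s:{0..y}. b x s)" if "(x, y) \<in> rect" for x y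
    unfolding J_def using that by (intro set_lebesgue_integral_cong) (auto simp: b_eq mem_rect)
  have J_meas [measurable]: "(\<lambda>z. J (fst z) (snd z)) \<in> borel_measurable joint"
  proof -
    have "(\<lambda>z. LBINT s:{0..snd z}. b (fst z) s) \<in> borel_measurable (borel \<Otimes>\<^sub>M borel)"
      unfolding set_lebesgue_integral_def
    proof (rule lborel.borel_measurable_lebesgue_integral)
      have eq: "(\<lambda>(z, s). indicator {0..snd z} s *\<^sub>R b (fst z) s)
          = (\<lambda>w. if 0 \<le> snd w \<and> snd w \<le> snd (fst w) then b (fst (fst w)) (snd w) else 0)"
        by (auto simp: fun_eq_iff indicator_def)
      have "(\<lambda>w. b (fst (fst w)) (snd w)) \<in> borel_measurable ((borel \<Otimes>\<^sub>M borel) \<Otimes>\<^sub>M lborel)"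
        using measurable_compose[OF _ b_meas, of "\<lambda>w. (fst (fst w), snd w)"
            "(borel \<Otimes>\<^sub>M borel) \<Otimes>\<^sub>M lborel"] by simp
      then show "(\<lambda>(z, s). indicator {0..snd z} s *\<^sub>R b (fst z) s)
          \<in> borel_measurable ((borel \<Otimes>\<^sub>M borel) \<Otimes>\<^sub>M lborel)"
        unfolding eq by measurable
    qed
    then have "(\<lambda>z. LBINT s:{0..snd z}. b (fst z) s) \<in> borel_measurable joint"
      by (rule joint_measurable)
    then show ?thesis
      by (subst measurable_cong[where g = "\<lambda>z. LBINT s:{0..snd z}. b (fst z) s"]) (auto simp: J_eq)
  qed
  have J_bound: "0 \<le> J x y" "J x y \<le> ubar" if "(x, y) \<in> rect" for x y
  proof -
    show "0 \<le> J x y"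
      unfolding J_eq[OF that] set_lebesgue_integral_def using b_bound by simp
    have "J x y \<le> (\<integral>s. indicator {0..ubar} s \<partial>lborel)"
      unfolding J_eq[OF that] set_lebesgue_integral_def using b_bound that
      by (intro integral_mono' integrable_real_indicator) (auto simp: indicator_def mem_rect)
    then show "J x y \<le> ubar"
      using U.b_pos by simp
  qed
  have "\<bar>J x y\<bar> \<le> ubar" if "(x, y) \<in> rect" for x y
    using J_bound[OF that] by simp
  then have int_J: "integrable joint (\<lambda>z. J (fst z) (snd z))"
    by (intro integrable_joint[where C = ubar]) auto
  have ya_bound: "0 \<le> y * a x y \<and> y * a x y \<le> ubar" if "(x, y) \<in> rect" for x y
    using bound[OF that] that mult_mono[of y ubar "a x y" 1] by (auto simp: mem_rect)
  then have int_ya: "integrable joint (\<lambda>z. snd z * a (fst z) (snd z))"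
    by (intro integrable_joint[where C = ubar]) auto
  have J_ya_bound: "\<bar>J x y - y * a x y\<bar> \<le> ubar" if "(x, y) \<in> rect" for x y
    using J_bound[OF that] ya_bound[OF that] by auto
  have rev: "revenue abar ubar f g a = (\<integral>z. J (fst z) (snd z) - snd z * a (fst z) (snd z) \<partial>joint)"
    unfolding revenue_def J_def[symmetric]
    using LBINT_eq_integral_joint[of "\<lambda>z. J (fst z) (snd z) - snd z * a (fst z) (snd z)" ubar]
      J_ya_bound by simp
  \<comment> \<open>The inverse hazard rate. The virtual surplus is \<open>k y - y\<close>, so the
    \<open>y\<close> part cancels against the payment term \<open>y * a x y\<close>.\<close>
  define k where "k y = (1 - cdf (law g) y) / g y" for y
  have [measurable]: "k \<in> borel_measurable borel"
    unfolding k_def[abs_def] by measurable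
  have r_k: "r y = k y - y" for y
    by (simp add: k_def virtual_surplus_def)
  have k_eq: "r y * a x y + y * a x y = k y * a x y" for x y
    by (simp add: r_k algebra_simps)
  have k_bound: "\<bar>k y * a x y\<bar> \<le> (r_bound + ubar) * 1" if "(x, y) \<in> rect" for x y
    unfolding abs_mult using bound[OF that] r_bound[of y] that r_k[of y]
    by (intro mult_mono) (auto simp: mem_rect r_bound_def)
  have "(\<integral>z. J (fst z) (snd z) \<partial>joint)
      = (\<integral>x. (\<integral>y. indicator rect (x, y) * J x y \<partial>law g) \<partial>law f)"
    using J_bound by (subst integral_joint_iterated(2)[where C = ubar]) auto
  also have "\<dots> = (\<integral>x. (\<integral>y. indicator rect (x, y) * (k y * a x y) \<partial>law g) \<partial>law f)"
  proof (rule Bochner_Integration.integral_cong)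
    fix x :: real
    show "(\<integral>y. indicator rect (x, y) * J x y \<partial>law g)
        = (\<integral>y. indicator rect (x, y) * (k y * a x y) \<partial>law g)"
    proof (cases "x \<in> {0..abar}")
      case True
      have "(\<integral>y. indicator rect (x, y) * J x y \<partial>law g) = (\<integral>y. (LBINT s:{0..y}. b x s) \<partial>law g)"
      proof (rule integral_cong_AE)
        have "(\<lambda>z. J (fst z) (snd z)) \<in> borel_measurable joint" by measurable
        from section_measurable(2)[OF this, of x]
        show "(\<lambda>y. indicator rect (x, y) * J x y) \<in> borel_measurable (law g)"
          by (simp cong: measurable_cong_sets)
        show "(\<lambda>y. LBINT s:{0..y}. b x s) \<in> borel_measurable (law g)"
          unfolding set_lebesgue_integral_def
        proof (rule lborel.borel_measurable_lebesgue_integral)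
          have eq: "(\<lambda>(y, s). indicator {0..y} s *\<^sub>R b x s)
              = (\<lambda>w. if 0 \<le> snd w \<and> snd w \<le> fst w then b x (snd w) else 0)"
            by (auto simp: fun_eq_iff indicator_def)
          have "(\<lambda>(y, s). indicator {0..y} s *\<^sub>R b x s) \<in> borel_measurable (borel \<Otimes>\<^sub>M borel)"
            unfolding eq by measurable
          then show "(\<lambda>(y, s). indicator {0..y} s *\<^sub>R b x s) \<in> borel_measurable (law g \<Otimes>\<^sub>M lborel)"
            by (simp cong: measurable_cong_sets sets_pair_measure_cong)
        qed
        show "AE y in law g. indicator rect (x, y) * J x y = (LBINT s:{0..y}. b x s)"
          using True by (intro eventually_mono[OF U.AE_law_range]) (auto simp: mem_rect J_eq)
      qed
      also have "\<dots> = (\<integral>y. k y * b x y \<partial>law g)"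
        unfolding k_def using b_bound
        by (intro U.integral_law_tail b_section) (auto simp: b_def rect_def)
      finally show ?thesis
        by (simp add: b_def mult_ac)
    qed (simp add: rect_def indicator_times)
  qed simp
  also have "\<dots> = (\<integral>z. k (snd z) * a (fst z) (snd z) \<partial>joint)"
    using k_bound by (subst integral_joint_iterated(2)[where C = "(r_bound + ubar) * 1"]) auto
  also have "\<dots> = (\<integral>z. r (snd z) * a (fst z) (snd z) \<partial>joint)
      + (\<integral>z. snd z * a (fst z) (snd z) \<partial>joint)"
    unfolding k_eq[symmetric]
    by (intro Bochner_Integration.integral_add integrable_r_allocation a int_ya)
  finally show rev_eq: "revenue abar ubar f g a = (\<integral>z. r (snd z) * a (fst z) (snd z) \<partial>joint)"
    using int_J int_ya by (simp add: rev)
  assume mono: "\<And>x y y'. (x, y) \<in> rect \<Longrightarrow> 0 \<le> y' \<Longrightarrow> y' \<le> y \<Longrightarrow> a x y \<le> a x y'"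
  have "y * a x y \<le> J x y" if "(x, y) \<in> rect" for x y
  proof -
    have int: "integrable lborel (\<lambda>s. indicator {0..y} s *\<^sub>R b x s)"
      using b_bound
      by (intro Bochner_Integration.integrable_bound[of lborel "indicator {0..y} :: real \<Rightarrow> real"
            "\<lambda>s. indicator {0..y} s *\<^sub>R b x s"] integrable_real_indicator AE_I2)
         (auto simp: indicator_def emeasure_lborel_Icc_eq)
    have "y * a x y = (\<integral>s. indicator {0..y} s * a x y \<partial>lborel)"
      using that by (simp add: mem_rect)
    also have "\<dots> \<le> J x y"
      unfolding J_eq[OF that] set_lebesgue_integral_def using that mono[OF that] b_bound
      by (intro integral_mono' int) (auto simp: indicator_def mem_rect b_eq)
    finally show ?thesis .
  qed
  then have "0 \<le> revenue abar ubar f g a"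
    unfolding rev by (intro integral_nonneg_AE AE_I2) auto
  then show "0 \<le> (\<integral>z. r (snd z) * a (fst z) (snd z) \<partial>joint)"
    by (simp add: rev_eq)
qed

section \<open>Bounds on \<open>K_low\<close>\<close>

lemma integral_joint_snd:
  fixes \<phi> :: "real \<Rightarrow> real"
  assumes [measurable]: "\<phi> \<in> borel_measurable borel"
    and "\<And>y. y \<in> {0..ubar} \<Longrightarrow> \<bar>\<phi> y\<bar> \<le> C"
  shows "(\<integral>z. \<phi> (snd z) \<partial>joint) = (LBINT y:{0..ubar}. g y * \<phi> y)"
proof -
  have "(LBINT x:{0..abar}. f x * c) = c" for c
  proof -
    have "(LBINT x:{0..abar}. f x * c) = (\<integral>x. indicator {0..abar} x * c \<partial>law f)"
      by (intro A.integral_law_interval) measurable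
    also have "\<dots> = (\<integral>x. c \<partial>law f)"
      by (intro integral_cong_AE eventually_mono[OF A.AE_law_range]) auto
    finally show ?thesis by (simp add: A.prob_space[simplified])
  qed
  from this[of 1] show ?thesis
    using LBINT_eq_integral_joint[of "\<lambda>z. \<phi> (snd z)" C] assms(2) by (simp add: mem_rect)
qed

text \<open>Treats both forms of \<open>t\<close> through one monotone threshold \<open>s\<close>.
  Monotonicity makes \<open>1 - F (s u)\<close> decreasing in \<open>u\<close>, as an allocation
  must be.\<close>

lemma alpha_star_family:
  assumes "t = (\<lambda>\<alpha> u. \<alpha>) \<or> t = (\<lambda>\<alpha> u. \<alpha> * u)"
  obtains s :: "real \<Rightarrow> real" where "mono s"
    and "\<And>u. 0 < u \<Longrightarrow> u \<le> v \<Longrightarrow> alpha_star t v u = s u"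
    and "s = (\<lambda>u. u) \<or> (s = (\<lambda>u. 1) \<and> t = (\<lambda>\<alpha> u. \<alpha> * u))"
  using assms
proof
  assume t: "t = (\<lambda>\<alpha> u. \<alpha>)"
  show thesis
    by (rule that[of "\<lambda>u. u"]) (auto simp: mono_def t alpha_star_id)
next
  assume t: "t = (\<lambda>\<alpha> u. \<alpha> * u)"
  show thesis
    by (rule that[of "\<lambda>u. 1"]) (auto simp: mono_def t alpha_star_mult)
qed

text \<open>The integrands may differ at \<open>u = 0\<close>, where \<open>alpha_star\<close> is
  unspecified; a single point does not affect the integral.\<close>

lemma LBINT_joint_cutoff:
  fixes h \<phi> :: "real \<Rightarrow> real"
  assumes [measurable]: "h \<in> borel_measurable borel" "\<phi> \<in> borel_measurable borel"
    and h': "\<And>u. 0 < u \<Longrightarrow> u \<le> v \<Longrightarrow> h' u = h u"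
    and bound: "\<And>y. y \<in> {0..ubar} \<Longrightarrow> \<bar>\<phi> y * h y\<bar> \<le> C"
    and "v \<le> ubar"
  shows "(LBINT u:{0..v}. h' u * (g u * \<phi> u)) = (\<integral>z. \<phi> (snd z) * (if snd z \<le> v then h (snd z) else 0) \<partial>joint)"
proof -
  have "0 \<le> C"
    using bound[of 0] U.b_pos by auto
  then have "(\<integral>z. \<phi> (snd z) * (if snd z \<le> v then h (snd z) else 0) \<partial>joint)
      = (LBINT y:{0..ubar}. g y * (\<phi> y * (if y \<le> v then h y else 0)))"
    using bound by (intro integral_joint_snd[where C = C]) auto
  also have "\<dots> = (LBINT u:{0..v}. h' u * (g u * \<phi> u))"
    unfolding set_lebesgue_integral_def using h' \<open>v \<le> ubar\<close>
    by (intro integral_discrete_difference[of "{0}"]) (auto simp: indicator_def)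
  finally show ?thesis by simp
qed

text \<open>Truncating \<open>1 - F (alpha_star t v u)\<close> at \<open>v\<close> gives a
  decreasing allocation \<open>k\<close>. The numerator \<open>N\<close> of \<open>K_low\<close> is
  its expected virtual surplus and the denominator \<open>D\<close> its expected size. So
  \<open>0 \<le> N\<close> by \<open>revenue_nonneg\<close>, and \<open>r v * D \<le> N\<close>
  because \<open>r\<close> is at least \<open>r v\<close> below \<open>v\<close>.\<close>

lemma K_low_bounds:
  assumes t: "t = (\<lambda>\<alpha> u. \<alpha>) \<or> t = (\<lambda>\<alpha> u. \<alpha> * u)"
    and v: "0 < v" "v < ubar"
  shows K_low_nonneg: "0 \<le> K_low f g t v"
    and K_low_ge: "r v \<le> K_low f g t v \<or> (t = (\<lambda>\<alpha> u. \<alpha> * u) \<and> abar \<le> 1)"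
proof -
  obtain s where "mono s" and s: "\<And>u. 0 < u \<Longrightarrow> u \<le> v \<Longrightarrow> alpha_star t v u = s u"
    and s_cases: "s = (\<lambda>u. u) \<or> (s = (\<lambda>u. 1) \<and> t = (\<lambda>\<alpha> u. \<alpha> * u))"
    using alpha_star_family[OF t] by blast
  have [measurable]: "s \<in> borel_measurable borel"
    using \<open>mono s\<close> by (rule borel_measurable_mono)
  define h where "h u = 1 - cdf (law f) (s u)" for u
  have h_meas [measurable]: "h \<in> borel_measurable borel"
    unfolding h_def[abs_def] by measurable
  have h_bounds: "0 \<le> h u" "h u \<le> 1" for u
    using A.cdf_law_bounds by (auto simp: h_def)
  have h_mono: "h u \<le> h u'" if "u' \<le> u" for u u'
    using \<open>mono s\<close> that by (simp add: h_def A.cdf_law_mono monoD)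
  define k where "k y = (if y \<le> v then h y else 0)" for y
  have alloc: "is_allocation (\<lambda>x. k)"
    using h_bounds unfolding is_allocation_def k_def[abs_def] by auto
  define N where "N = (\<integral>z. r (snd z) * k (snd z) \<partial>joint)"
  define D where "D = (\<integral>z. k (snd z) \<partial>joint)"
  have "\<bar>r y * h y\<bar> \<le> r_bound * 1" if "y \<in> {0..ubar}" for y
    unfolding abs_mult using that r_bound[of y] h_bounds[of y]
    by (intro mult_mono) (auto simp: r_bound_def)
  then have "(LBINT u:{0..v}. (1 - cdf (law f) (alpha_star t v u)) * (g u * r u)) = N"
    unfolding N_def k_def using v s
    by (intro LBINT_joint_cutoff) (auto simp: h_def)
  also have "(LBINT u:{0..v}. (1 - cdf (law f) (alpha_star t v u)) * (g u * r u))
      = (LBINT u:{0..v}. (1 - cdf (law f) (alpha_star t v u)) * (1 - cdf (law g) u - u * g u))"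
    using v by (intro set_lebesgue_integral_cong) (auto simp: U.density_times_virtual_surplus)
  finally have N: "(LBINT u:{0..v}. (1 - cdf (law f) (alpha_star t v u)) * (1 - cdf (law g) u - u * g u)) = N" .
  have "(LBINT u:{0..v}. (1 - cdf (law f) (alpha_star t v u)) * (g u * 1)) = (\<integral>z. 1 * (if snd z \<le> v then h (snd z) else 0) \<partial>joint)"
    using v s h_bounds by (intro LBINT_joint_cutoff[where C = 1]) (auto simp: h_def)
  then have D: "(LBINT u:{0..v}. (1 - cdf (law f) (alpha_star t v u)) * g u) = D"
    by (simp add: D_def k_def)
  have K_low_eq: "K_low f g t v = N / D"
    by (simp add: K_low_def N D)
  have D_nonneg: "0 \<le> D"
    unfolding D_def using h_bounds by (intro Bochner_Integration.integral_nonneg) (auto simp: k_def)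
  have "0 \<le> N"
    unfolding N_def using h_mono h_bounds v
    by (intro revenue_nonneg[OF alloc]) (auto simp: k_def)
  with D_nonneg show "0 \<le> K_low f g t v"
    by (simp add: K_low_eq)
  have "r v * D = (\<integral>z. r v * k (snd z) \<partial>joint)"
    by (simp add: D_def)
  also have "\<dots> \<le> N"
    unfolding N_def
  proof (rule integral_mono)
    fix z assume "z \<in> space joint"
    then show "r v * k (snd z) \<le> r (snd z) * k (snd z)"
      using r_mono[of "snd z" v] h_bounds v
      by (cases z) (auto simp: k_def mem_rect intro!: mult_right_mono)
  qed (use integrable_allocation[OF alloc] integrable_r_allocation[OF alloc] in auto)
  finally have ge: "r v * D \<le> N" .
  show "r v \<le> K_low f g t v \<or> (t = (\<lambda>\<alpha> u. \<alpha> * u) \<and> abar \<le> 1)"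
  proof (cases "D = 0")
    case False
    with D_nonneg ge show ?thesis
      by (simp add: K_low_eq pos_le_divide_eq)
  next
    case True
    have "AE z in joint. k (snd z) = 0"
      using True integrable_allocation[OF alloc] h_bounds unfolding D_def
      by (subst (asm) integral_nonneg_eq_0_iff_AE) (auto simp: k_def)
    then have "AE x in lborel. x \<in> {0..abar} \<longrightarrow>
        (AE y in lborel. 0 < y \<and> y \<in> {0..ubar} \<longrightarrow> k y = 0)"
      by (intro AE_joint_imp[where a = "\<lambda>x. k"]) auto
    then have "AE x in lborel. 0 < x \<and> x < abar \<longrightarrow>
        (AE y in lborel. 0 < y \<and> y \<in> {0..ubar} \<longrightarrow> k y = 0)"
      by (rule eventually_mono) auto
    from AE_interval_witness[OF this A.b_pos]
    have "AE y in lborel. 0 < y \<and> y \<in> {0..ubar} \<longrightarrow> k y = 0" by blast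
    \<comment> \<open>When \<open>D = 0\<close>, a witness \<open>y < v\<close> has
      \<open>F (s y) = 1\<close>, hence \<open>abar \<le> s y\<close>. Taking also
      \<open>y < abar\<close> excludes \<open>s y = y\<close>, so \<open>s\<close> is constantly 1
      and \<open>abar \<le> 1\<close>.\<close>
    then have *: "AE y in lborel. 0 < y \<and> y < min v abar \<longrightarrow> k y = 0"
      using v by (rule_tac eventually_mono) auto
    obtain y where y: "0 < y" "y < min v abar" "k y = 0"
      using AE_interval_witness[OF *] v A.b_pos by auto
    then have "abar \<le> s y"
      by (intro A.cdf_law_eq_1_imp) (auto simp: k_def h_def)
    then show ?thesis
      using s_cases y by auto
  qed
qed

end

subsection \<open>The regulator's problem\<close>

locale regulator = regular_types +
  fixes t :: "real \<Rightarrow> real \<Rightarrow> real" and v K :: real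
  assumes t: "t = (\<lambda>\<alpha> u. \<alpha>) \<or> t = (\<lambda>\<alpha> u. \<alpha> * u)"
    and v_pos: "0 < v" and v_less: "v < ubar"
    and K_gt: "K_low f g t v < K"
begin

lemma K_pos: "0 < K"
  using K_low_nonneg[OF t v_pos v_less] K_gt by simp

section \<open>Net losses compared with those at \<open>u = v\<close>\<close>

definition net_loss :: "real \<Rightarrow> real \<Rightarrow> real" where
  "net_loss x y = y - min v (t x y)"

lemma t_nonneg: "0 \<le> x \<Longrightarrow> 0 \<le> y \<Longrightarrow> 0 \<le> t x y"
  using t by auto

lemma net_loss_measurable [measurable]:
  "(\<lambda>z. net_loss (fst z) (snd z)) \<in> borel_measurable (borel \<Otimes>\<^sub>M borel)"
  "(\<lambda>x. net_loss x y) \<in> borel_measurable borel"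
  using t unfolding net_loss_def by auto

lemma net_loss_bound: "(x, y) \<in> rect \<Longrightarrow> \<bar>net_loss x y\<bar> \<le> ubar"
  using t_nonneg[of x y] v_pos v_less by (auto simp: net_loss_def mem_rect)

lemma net_loss_at_v_nonneg: "0 \<le> net_loss x v"
  by (simp add: net_loss_def)

text \<open>In the product case with \<open>x \<le> 1\<close> the loss below \<open>v\<close> is
  \<open>(1 - x) * y\<close>, increasing in \<open>y\<close>; with \<open>x \<ge> 1\<close> it is at
  most 0, its value at \<open>v\<close>.\<close>

lemma net_loss_below:
  assumes "0 \<le> x" "0 \<le> y" "y \<le> v"
  shows "net_loss x y \<le> net_loss x v"
proof (cases "t = (\<lambda>\<alpha> u. \<alpha> * u)")
  case True
  then have t_eq: "t p q = p * q" for p q by simp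
  have "(1 - x) * y \<le> (1 - x) * v" if "x \<le> 1"
    using that assms by (intro mult_left_mono) auto
  moreover have "y \<le> x * y" if "1 \<le> x"
    using mult_right_mono[OF that, of y] assms by simp
  ultimately show ?thesis
    using assms by (cases "x \<le> 1") (auto simp: t_eq net_loss_def min_def algebra_simps)
next
  case False
  then have t_eq: "t p q = p" for p q using t by metis
  show ?thesis
    using assms by (auto simp: t_eq net_loss_def min_def)
qed

text \<open>The strict inequality is the source of the conclusion: serving a positive mass above
  \<open>v\<close> must cost something.\<close>

lemma net_loss_above:
  assumes "0 \<le> x" "v < y"
  shows "net_loss x v < net_loss x y"
proof (cases "t = (\<lambda>\<alpha> u. \<alpha> * u)")
  case True
  then have t_eq: "t p q = p * q" for p q by simp
  have "(1 - x) * v < (1 - x) * y" if "x < 1"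
    using that assms by (intro mult_strict_left_mono) auto
  moreover have "v \<le> x * v" if "1 \<le> x"
    using mult_right_mono[OF that, of v] v_pos by simp
  ultimately show ?thesis
    using assms by (cases "x < 1") (auto simp: t_eq net_loss_def min_def algebra_simps)
next
  case False
  then have t_eq: "t p q = p" for p q using t by metis
  show ?thesis
    using assms by (auto simp: t_eq net_loss_def min_def)
qed

section \<open>Constraints and objective as expectations\<close>

definition admissible :: "(real \<Rightarrow> real \<Rightarrow> real) \<Rightarrow> (real \<Rightarrow> real \<Rightarrow> real) \<Rightarrow> bool" where
  "admissible a c \<longleftrightarrow> is_allocation a \<and> is_allocation c \<and>
     (\<forall>x y. (x, y) \<in> rect \<longrightarrow> a x y - a x y * c x y \<le> a 0 y \<and> c x y \<le> a x y \<and> a 0 y \<le> a x y \<and>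
        (\<forall>y'. 0 \<le> y' \<longrightarrow> y' \<le> y \<longrightarrow> a x y \<le> a x y'))"

definition budget :: "(real \<Rightarrow> real \<Rightarrow> real) \<Rightarrow> (real \<Rightarrow> real \<Rightarrow> real) \<Rightarrow> real" where
  "budget a c = (\<integral>z. r (snd z) * a (fst z) (snd z) \<partial>joint) - K * (\<integral>z. c (fst z) (snd z) \<partial>joint)"

lemma is_allocation_iff:
  "is_allocation a \<longleftrightarrow>
    set_borel_measurable borel ({0..abar} \<times> {0..ubar}) (\<lambda>(\<alpha>, u). a \<alpha> u) \<and>
    (\<forall>\<alpha>\<in>{0..abar}. \<forall>u\<in>{0..ubar}. a \<alpha> u \<in> {0..1})"
  by (auto simp: is_allocation_def joint_measurable_iff set_borel_measurable_def borel_prod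
      split_beta' mem_rect rect_def)

lemma feasible_iff: "feasible abar ubar f g K a c \<longleftrightarrow> admissible a c \<and> 0 \<le> budget a c"
proof -
  have budget: "K * inspections abar ubar f g c \<le> revenue abar ubar f g a \<longleftrightarrow> 0 \<le> budget a c"
    if "is_allocation a" "is_allocation c"
    using that by (simp add: budget_def revenue_eq inspections_eq)
  show ?thesis
  proof
    assume F: "feasible abar ubar f g K a c"
    then have alloc: "is_allocation a" "is_allocation c"
      by (auto simp: feasible_def is_allocation_iff)
    have "a x y - a x y * c x y \<le> a 0 y \<and> c x y \<le> a x y \<and> a 0 y \<le> a x y" if "(x, y) \<in> rect" for x y
      using F that unfolding feasible_def mem_rect by simp
    moreover have "a x y \<le> a x y'" if "(x, y) \<in> rect" "0 \<le> y'" "y' \<le> y" for x y y'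
      using F that unfolding feasible_def mem_rect by simp
    ultimately show "admissible a c \<and> 0 \<le> budget a c"
      using F alloc budget[OF alloc] by (simp add: admissible_def feasible_def)
  next
    assume A: "admissible a c \<and> 0 \<le> budget a c"
    then have "is_allocation a" "is_allocation c"
      by (auto simp: admissible_def)
    with A budget show "feasible abar ubar f g K a c"
      unfolding feasible_def admissible_def by (auto simp: is_allocation_iff mem_rect)
  qed
qed

lemma integrable_times_allocation:
  assumes a: "is_allocation a" and [measurable]: "\<phi> \<in> borel_measurable joint"
    and bound: "\<And>x y. (x, y) \<in> rect \<Longrightarrow> \<bar>\<phi> (x, y)\<bar> \<le> C"
  shows "integrable joint (\<lambda>z. \<phi> z * a (fst z) (snd z))"
proof (rule integrable_joint[where C = "C * 1"])
  have [measurable]: "(\<lambda>z. a (fst z) (snd z)) \<in> borel_measurable joint"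
    using a by (simp add: is_allocation_def)
  show "(\<lambda>z. \<phi> z * a (fst z) (snd z)) \<in> borel_measurable joint"
    by measurable
  fix x y assume xy: "(x, y) \<in> rect"
  show "\<bar>\<phi> (x, y) * a (fst (x, y)) (snd (x, y))\<bar> \<le> C * 1"
    unfolding abs_mult using a bound[OF xy] xy
    by (intro mult_mono) (auto simp: is_allocation_def)
qed

lemma integrable_net_loss:
  "is_allocation a \<Longrightarrow> integrable joint (\<lambda>z. net_loss (fst z) (snd z) * a (fst z) (snd z))"
  by (rule integrable_times_allocation[where C = ubar and \<phi> = "\<lambda>z. net_loss (fst z) (snd z)"])
     (auto intro: net_loss_bound joint_measurable)

lemma welfare_eq:
  assumes a: "is_allocation a"
  shows "welfare abar ubar f g t v a = - (\<integral>z. net_loss (fst z) (snd z) * a (fst z) (snd z) \<partial>joint)"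
proof -
  have "\<bar>- (net_loss x y * a x y)\<bar> \<le> ubar * 1" if "(x, y) \<in> rect" for x y
    unfolding abs_minus abs_mult using a net_loss_bound[OF that] that
    by (intro mult_mono) (auto simp: is_allocation_def)
  then have "(LBINT y:{0..ubar}. g y * (LBINT x:{0..abar}. f x *
        (\<lambda>z. - (net_loss (fst z) (snd z) * a (fst z) (snd z))) (x, y)))
      = (\<integral>z. - (net_loss (fst z) (snd z) * a (fst z) (snd z)) \<partial>joint)"
    using integrable_net_loss[OF a]
    by (intro LBINT_eq_integral_joint[where C = "ubar * 1"]) auto
  moreover have "(min v (t x y) - y) * a x y = - (net_loss x y * a x y)" for x y
    by (simp add: net_loss_def algebra_simps)
  ultimately show ?thesis
    by (simp add: welfare_def)
qed

section \<open>Truncation at \<open>v\<close> and mixing with the posted price\<close>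

text \<open>Mixing \<open>(a, c)\<close>, cut off at \<open>v\<close>, with the inspection-free posted price \<open>v\<close>. The mixture
  satisfies the non-convex constraint because \<open>a\<close> only grows while \<open>c\<close> is scaled down.\<close>

definition mix_a :: "real \<Rightarrow> (real \<Rightarrow> real \<Rightarrow> real) \<Rightarrow> real \<Rightarrow> real \<Rightarrow> real" where
  "mix_a \<theta> a x y = (if y \<le> v then (1 - \<theta>) * a x y + \<theta> else 0)"

definition mix_c :: "real \<Rightarrow> (real \<Rightarrow> real \<Rightarrow> real) \<Rightarrow> real \<Rightarrow> real \<Rightarrow> real" where
  "mix_c \<theta> c x y = (if y \<le> v then (1 - \<theta>) * c x y else 0)"

lemma is_allocation_mix:
  assumes a: "is_allocation a" and \<theta>: "0 \<le> \<theta>" "\<theta> \<le> 1"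
  shows "is_allocation (mix_a \<theta> a)" "is_allocation (mix_c \<theta> a)"
proof -
  have [measurable]: "(\<lambda>z. a (fst z) (snd z)) \<in> borel_measurable joint"
    and bound: "\<And>x y. (x, y) \<in> rect \<Longrightarrow> 0 \<le> a x y \<and> a x y \<le> 1"
    using a by (auto simp: is_allocation_def)
  have "(1 - \<theta>) * a x y \<le> 1 - \<theta> \<and> 0 \<le> (1 - \<theta>) * a x y" if "(x, y) \<in> rect" for x y
    using bound[OF that] \<theta> by (auto intro: mult_left_le)
  then show "is_allocation (mix_a \<theta> a)" "is_allocation (mix_c \<theta> a)"
    using \<theta> unfolding is_allocation_def mix_a_def mix_c_def by (auto; fastforce)+
qed

lemma admissible_mix:
  assumes adm: "admissible a c" and \<theta>: "0 \<le> \<theta>" "\<theta> \<le> 1"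
  shows "admissible (mix_a \<theta> a) (mix_c \<theta> c)"
proof -
  let ?a = "mix_a \<theta> a" and ?c = "mix_c \<theta> c"
  have alloc: "is_allocation a" "is_allocation c"
    using adm by (auto simp: admissible_def)
  have "?a x y - ?a x y * ?c x y \<le> ?a 0 y \<and> ?c x y \<le> ?a x y \<and> ?a 0 y \<le> ?a x y \<and>
      (\<forall>y'. 0 \<le> y' \<longrightarrow> y' \<le> y \<longrightarrow> ?a x y \<le> ?a x y')" if xy: "(x, y) \<in> rect" for x y
  proof (cases "y \<le> v")
    case True
    have b: "0 \<le> a x y" "a x y \<le> 1" "0 \<le> c x y"
      using alloc xy by (auto simp: is_allocation_def)
    have ad: "a x y - a x y * c x y \<le> a 0 y" "c x y \<le> a x y" "a 0 y \<le> a x y"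
      and mono: "\<And>y'. 0 \<le> y' \<Longrightarrow> y' \<le> y \<Longrightarrow> a x y \<le> a x y'"
      using adm xy by (auto simp: admissible_def)
    have le: "(1 - \<theta>) * s \<le> (1 - \<theta>) * s'" if "s \<le> s'" for s s' :: real
      using that \<theta> by (intro mult_left_mono) auto
    have "0 \<le> ((1 - \<theta>) * c x y) * (\<theta> * (1 - a x y))"
      using b \<theta> by simp
    \<comment> \<open>The product of mixed allocation and mixed inspection exceeds
      \<open>(1 - \<theta>) * a x y * c x y\<close> by exactly the nonnegative term above.\<close>
    then have "?a x y - ?a x y * ?c x y \<le> (1 - \<theta>) * (a x y - a x y * c x y) + \<theta>"
      using True by (simp add: mix_a_def mix_c_def algebra_simps)
    also have "\<dots> \<le> ?a 0 y"
      using le[OF ad(1)] True by (simp add: mix_a_def)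
    finally show ?thesis
      using le[OF ad(2)] le[OF ad(3)] le[OF mono] True \<theta>
      by (auto simp: mix_a_def mix_c_def)
  next
    case False
    have "0 \<le> mix_a \<theta> a x y'" if "0 \<le> y'" "y' \<le> y" for y'
      using is_allocation_mix(1)[OF alloc(1) \<theta>] xy that by (auto simp: is_allocation_def mem_rect)
    with False show ?thesis
      by (simp add: mix_a_def mix_c_def)
  qed
  then show ?thesis
    using is_allocation_mix(1)[OF alloc(1) \<theta>] is_allocation_mix(2)[OF alloc(2) \<theta>]
    by (auto simp: admissible_def)
qed

text \<open>A nonnegative integrand with nonpositive integral is zero almost everywhere; as the
  weight \<psi> is positive above \<open>v\<close>, the factor \<open>a\<close> must vanish
  there.\<close>

lemma vanishes_above:
  assumes a: "is_allocation a"
    and meas [measurable]: "\<psi> \<in> borel_measurable joint"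
    and bound: "\<And>x y. (x, y) \<in> rect \<Longrightarrow> \<bar>\<psi> (x, y)\<bar> \<le> C"
    and pos: "\<And>x y. (x, y) \<in> rect \<Longrightarrow> v < y \<Longrightarrow> 0 < \<psi> (x, y)"
    and le: "(\<integral>z. (if v < snd z then \<psi> z else 0) * a (fst z) (snd z) \<partial>joint) \<le> 0"
  shows "AE z in joint. v < snd z \<longrightarrow> a (fst z) (snd z) = 0"
proof -
  let ?X = "\<lambda>z. (if v < snd z then \<psi> z else 0) * a (fst z) (snd z)"
  have "0 \<le> C" using bound[of 0 0] A.b_pos U.b_pos by (auto simp: mem_rect)
  then have int: "integrable joint ?X"
    using bound by (intro integrable_times_allocation[OF a, where C = C]) auto
  have nonneg: "AE z in joint. 0 \<le> ?X z"
    using a pos by (intro AE_I2) (auto simp: is_allocation_def less_imp_le)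
  then have "(\<integral>z. ?X z \<partial>joint) = 0"
    using le integral_nonneg_AE[OF nonneg] by simp
  then have "AE z in joint. ?X z = 0"
    using integral_nonneg_eq_0_iff_AE[OF int nonneg] by simp
  moreover have "AE z in joint. v < snd z \<longrightarrow> \<psi> z \<noteq> 0"
    using pos by (intro AE_I2) (auto dest: less_imp_neq[OF pos])
  ultimately show ?thesis
    by eventually_elim auto
qed

definition loss :: "(real \<Rightarrow> real \<Rightarrow> real) \<Rightarrow> real" where
  "loss a = (\<integral>z. net_loss (fst z) (snd z) * a (fst z) (snd z) \<partial>joint)"

definition posted :: "real \<Rightarrow> real \<Rightarrow> real" where
  "posted x y = (if y \<le> v then 1 else 0)"

lemma is_allocation_posted: "is_allocation posted"
  unfolding is_allocation_def posted_def by auto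

lemma is_allocation_zero: "is_allocation (\<lambda>x y. 0)"
  unfolding is_allocation_def by auto

lemmas integrable_simps =
  integrable_allocation integrable_r_allocation integrable_net_loss

text \<open>The mixture is an affine combination of the truncation (\<theta> = 0) and the posted
  price, and both \<open>loss\<close> and \<open>budget\<close> are linear.\<close>

lemma
  assumes a: "is_allocation a" and c: "is_allocation c"
  shows loss_mix: "loss (mix_a \<theta> a) = (1 - \<theta>) * loss (mix_a 0 a) + \<theta> * loss posted"
    and budget_mix: "budget (mix_a \<theta> a) (mix_c \<theta> c)
      = (1 - \<theta>) * budget (mix_a 0 a) (mix_c 0 c) + \<theta> * budget posted (\<lambda>x y. 0)"
proof -
  note alloc = is_allocation_mix(1)[OF a, of 0, simplified] is_allocation_mix(2)[OF c, of 0, simplified]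
    is_allocation_posted
  have mix: "mix_a \<theta> a = (\<lambda>x y. (1 - \<theta>) * mix_a 0 a x y + \<theta> * posted x y)"
    "mix_c \<theta> c = (\<lambda>x y. (1 - \<theta>) * mix_c 0 c x y)"
    by (auto simp: fun_eq_iff mix_a_def mix_c_def posted_def)
  have lin: "(\<integral>z. w z * mix_a \<theta> a (fst z) (snd z) \<partial>joint)
      = (1 - \<theta>) * (\<integral>z. w z * mix_a 0 a (fst z) (snd z) \<partial>joint) + \<theta> * (\<integral>z. w z * posted (fst z) (snd z) \<partial>joint)"
    if "integrable joint (\<lambda>z. w z * mix_a 0 a (fst z) (snd z))"
      "integrable joint (\<lambda>z. w z * posted (fst z) (snd z))" for w :: "real \<times> real \<Rightarrow> real"
  proof -
    have "w z * mix_a \<theta> a (fst z) (snd z) = (1 - \<theta>) * (w z * mix_a 0 a (fst z) (snd z))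
        + \<theta> * (w z * posted (fst z) (snd z))" for z
      by (simp add: mix(1) algebra_simps)
    then show ?thesis
      using that by simp
  qed
  show "loss (mix_a \<theta> a) = (1 - \<theta>) * loss (mix_a 0 a) + \<theta> * loss posted"
    unfolding loss_def by (intro lin integrable_net_loss alloc)
  have c_eq: "(\<integral>z. mix_c \<theta> c (fst z) (snd z) \<partial>joint) = (1 - \<theta>) * (\<integral>z. mix_c 0 c (fst z) (snd z) \<partial>joint)"
    unfolding mix(2) by simp
  show "budget (mix_a \<theta> a) (mix_c \<theta> c)
      = (1 - \<theta>) * budget (mix_a 0 a) (mix_c 0 c) + \<theta> * budget posted (\<lambda>x y. 0)"
    unfolding budget_def
    by (subst lin[OF integrable_r_allocation[OF alloc(1)] integrable_r_allocation[OF alloc(3)]])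
       (simp add: c_eq algebra_simps)
qed

text \<open>Truncation changes \<open>a\<close> only above \<open>v\<close>, so the loss it saves is
  the one incurred there.\<close>

lemma loss_diff_above:
  assumes a: "is_allocation a"
  shows "(\<integral>z. (if v < snd z then net_loss (fst z) (snd z) else 0) * a (fst z) (snd z) \<partial>joint)
    = loss a - loss (mix_a 0 a)"
proof -
  have "(if v < snd z then net_loss (fst z) (snd z) else 0) * a (fst z) (snd z)
      = net_loss (fst z) (snd z) * a (fst z) (snd z)
        - net_loss (fst z) (snd z) * mix_a 0 a (fst z) (snd z)" for z
    by (simp add: mix_a_def)
  then show ?thesis
    using integrable_net_loss[OF a] integrable_net_loss[OF is_allocation_mix(1)[OF a, of 0]]
    by (simp add: loss_def)
qed

text \<open>If \<open>r v \<le> 0\<close>, the virtual surplus is nonpositive on all removed types,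
  and removing inspections saves money because \<open>K\<close> is positive.\<close>

lemma budget_truncation:
  assumes adm: "admissible a c" and "r v \<le> 0"
  shows "budget a c \<le> budget (mix_a 0 a) (mix_c 0 c)"
proof -
  have a: "is_allocation a" and c: "is_allocation c"
    using adm by (auto simp: admissible_def)
  note alloc = a c is_allocation_mix(1)[OF a, of 0, simplified] is_allocation_mix(2)[OF c, of 0, simplified]
  have "(\<integral>z. r (snd z) * a (fst z) (snd z) \<partial>joint) \<le> (\<integral>z. r (snd z) * mix_a 0 a (fst z) (snd z) \<partial>joint)"
  proof (rule integral_mono)
    fix z assume "z \<in> space joint"
    then show "r (snd z) * a (fst z) (snd z) \<le> r (snd z) * mix_a 0 a (fst z) (snd z)"
      using a r_mono[of v "snd z"] \<open>r v \<le> 0\<close> v_pos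
      by (cases z) (auto simp: mix_a_def is_allocation_def mem_rect intro!: mult_nonpos_nonneg)
  qed (intro integrable_r_allocation alloc)+
  moreover have "(\<integral>z. mix_c 0 c (fst z) (snd z) \<partial>joint) \<le> (\<integral>z. c (fst z) (snd z) \<partial>joint)"
  proof (rule integral_mono)
    fix z assume "z \<in> space joint"
    then show "mix_c 0 c (fst z) (snd z) \<le> c (fst z) (snd z)"
      using c by (cases z) (auto simp: mix_c_def is_allocation_def)
  qed (intro integrable_allocation alloc)+
  ultimately show ?thesis
    using K_pos unfolding budget_def by (intro diff_mono mult_left_mono) auto
qed

section \<open>The Lagrangian comparison\<close>

text \<open>The Lagrangian with multiplier \<open>D / r v\<close>, \<open>D\<close> the expected net loss at \<open>u = v\<close>: at this
  multiplier serving everybody at \<open>u = v\<close> breaks even, so the posted price \<open>v\<close> maximizes it.\<close>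

definition D :: real where "D = (\<integral>x. net_loss x v \<partial>law f)"

definition lagrangian :: "(real \<Rightarrow> real \<Rightarrow> real) \<Rightarrow> (real \<Rightarrow> real \<Rightarrow> real) \<Rightarrow> real" where
  "lagrangian a c = - loss a + D / r v * budget a c"

lemma D_nonneg: "0 \<le> D"
  unfolding D_def using net_loss_at_v_nonneg by simp

text \<open>The line \<alpha> = 0 is a null set, so \<open>a 0\<close> is controlled not through
  integrals but as a section of a jointly Borel function.\<close>

lemma common_section_measurable:
  assumes a: "is_allocation a"
  shows "(\<lambda>(x, y). a 0 y) \<in> borel_measurable joint"
proof -
  have "(\<lambda>z. a (fst z) (snd z)) \<in> borel_measurable joint"
    using a by (simp add: is_allocation_def)
  from section_measurable(2)[OF this, of 0]
  have "(\<lambda>y. indicator rect (0, y) * a 0 y) \<in> borel_measurable borel"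
    by simp
  from measurable_compose[OF snd_joint this]
  show ?thesis
    by (rule measurable_cong[THEN iffD1, rotated]) (use A.b_pos in \<open>auto simp: mem_rect\<close>)
qed

text \<open>Since \<open>D\<close> is the mean of the loss at \<open>v\<close>, the two may be
  exchanged under the integral against any weight in \<open>u\<close> alone. The comparisons below
  hold pointwise only after adding such a term.\<close>

lemma net_loss_centred:
  fixes \<phi> :: "real \<Rightarrow> real"
  assumes "(\<lambda>(x, y). \<phi> y) \<in> borel_measurable joint"
    and "\<And>y. y \<in> {0..ubar} \<Longrightarrow> \<bar>\<phi> y\<bar> \<le> C"
  shows "(\<integral>z. (D - net_loss (fst z) v) * \<phi> (snd z) \<partial>joint) = 0"
  using integral_joint_centred[of "\<lambda>x. net_loss x v" \<phi> ubar C] assms net_loss_bound[of _ v] v_pos v_less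
  by (simp add: D_def mem_rect split_beta')

lemma integrable_centred:
  fixes \<phi> :: "real \<Rightarrow> real"
  assumes meas: "(\<lambda>(x, y). \<phi> y) \<in> borel_measurable joint"
    and "\<And>y. y \<in> {0..ubar} \<Longrightarrow> 0 \<le> \<phi> y \<and> \<phi> y \<le> 1"
  shows "integrable joint (\<lambda>z. (D - net_loss (fst z) v) * \<phi> (snd z))"
proof (rule integrable_times_allocation[where C = "D + ubar" and a = "\<lambda>x. \<phi>"])
  show "is_allocation (\<lambda>x. \<phi>)"
    using assms by (auto simp: is_allocation_def split_beta' mem_rect)
  show "\<bar>D - net_loss (fst (x, y)) v\<bar> \<le> D + ubar" if "(x, y) \<in> rect" for x y
    using net_loss_bound[of x v] that v_pos v_less D_nonneg by (auto simp: mem_rect abs_le_iff)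
  have "(\<lambda>z. D - net_loss (fst z) v) \<in> borel_measurable (borel \<Otimes>\<^sub>M borel)"
    by (intro borel_measurable_diff measurable_compose[OF measurable_fst] net_loss_measurable) auto
  then show "(\<lambda>z. D - net_loss (fst z) v) \<in> borel_measurable joint"
    by (rule joint_measurable)
qed

text \<open>Collects a difference of Lagrangians into one integrand, so that mechanisms can be
  compared type by type.\<close>

lemma lagrangian_diff:
  assumes "is_allocation a" "is_allocation a'" "is_allocation c" "is_allocation c'"
  defines "X \<equiv> \<lambda>z. net_loss (fst z) (snd z) * a' (fst z) (snd z) - net_loss (fst z) (snd z) * a (fst z) (snd z)
        + D / r v * (r (snd z) * a (fst z) (snd z) - r (snd z) * a' (fst z) (snd z))
        + D / r v * K * (c' (fst z) (snd z) - c (fst z) (snd z))"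
  shows "lagrangian a c - lagrangian a' c' = (\<integral>z. X z \<partial>joint)" and "integrable joint X"
proof -
  note integrable_simps[OF assms(1), simp] integrable_simps[OF assms(2), simp]
    integrable_simps[OF assms(3), simp] integrable_simps[OF assms(4), simp]
  show "integrable joint X"
    unfolding X_def by simp
  show "lagrangian a c - lagrangian a' c' = (\<integral>z. X z \<partial>joint)"
  proof -
    have "(\<integral>z. X z \<partial>joint) = loss a' - loss a
        + D / r v * ((\<integral>z. r (snd z) * a (fst z) (snd z) \<partial>joint) - (\<integral>z. r (snd z) * a' (fst z) (snd z) \<partial>joint))
        + D / r v * K * ((\<integral>z. c' (fst z) (snd z) \<partial>joint) - (\<integral>z. c (fst z) (snd z) \<partial>joint))"
      unfolding X_def loss_def by simp
    then show ?thesis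
      by (simp add: lagrangian_def budget_def algebra_simps)
  qed
qed

text \<open>Assumption \<open>opt\<close> tests \<open>a\<close> only against affordable mixtures;
  \<theta> = 0 is plain truncation.\<close>

lemma optimal_vanishes_above:
  assumes adm: "admissible a c" and bud: "0 \<le> budget a c" and "r v \<le> K"
    and opt: "\<And>\<theta>. 0 \<le> \<theta> \<Longrightarrow> \<theta> \<le> 1 \<Longrightarrow> 0 \<le> budget (mix_a \<theta> a) (mix_c \<theta> c) \<Longrightarrow> loss a \<le> loss (mix_a \<theta> a)"
  shows "AE z in joint. v < snd z \<longrightarrow> a (fst z) (snd z) = 0"
proof -
  have a: "is_allocation a" and c: "is_allocation c"
    using adm by (auto simp: admissible_def)
  let ?aT = "mix_a 0 a" and ?cT = "mix_c 0 c" and ?p = posted and ?z = "\<lambda>x y. 0 :: real"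
  have aT: "is_allocation ?aT" and cT: "is_allocation ?cT"
    using is_allocation_mix a c by auto
  note p = is_allocation_posted and z = is_allocation_zero
  show ?thesis
  proof (cases "0 \<le> budget ?aT ?cT")
    case True
    \<comment> \<open>An affordable truncation cannot reduce the loss, yet every type above
      \<open>v\<close> has positive loss, so nothing is allocated there.\<close>
    then have "loss a \<le> loss ?aT"
      by (intro opt) auto
    then show ?thesis
      using net_loss_above net_loss_at_v_nonneg net_loss_bound loss_diff_above[OF a]
      by (intro vanishes_above[OF a, where \<psi> = "\<lambda>z. net_loss (fst z) (snd z)" and C = ubar])
         (auto simp: mem_rect intro: joint_measurable le_less_trans)
  next
    case False
    \<comment> \<open>Truncation breaks a budget that held before, which
      \<open>budget_truncation\<close> rules out for nonpositive \<open>r v\<close>. Hence the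
      multiplier is well defined.\<close>
    then have rho: "0 < r v"
      using budget_truncation[OF adm] bud by fastforce
    define lam where "lam = D / r v"
    have lagrangian_eq: "lagrangian a' c' = - loss a' + lam * budget a' c'" for a' c'
      by (simp add: lagrangian_def lam_def)
    have lam: "0 \<le> lam" "lam * r v = D"
      using rho D_nonneg by (auto simp: lam_def)
    \<comment> \<open>Priced by the multiplier, an inspection costs at least the average loss of
      serving at \<open>u = v\<close>.\<close>
    have lamK: "D \<le> lam * K"
      using mult_left_mono[OF \<open>r v \<le> K\<close> lam(1)] lam(2) by simp
    have pointwise: "0 \<le> a x y" "a x y \<le> 1" "0 \<le> a 0 y" "a 0 y \<le> a x y"
        "a x y - a 0 y \<le> c x y" "D * (a x y - a 0 y) \<le> lam * K * c x y"
        "net_loss x v * a 0 y \<le> net_loss x v * a x y" if xy: "(x, y) \<in> rect" for x y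
    proof -
      show *: "0 \<le> a x y" "a x y \<le> 1" "a 0 y \<le> a x y"
        using a adm xy by (auto simp: is_allocation_def admissible_def)
      show "0 \<le> a 0 y"
        using a xy A.b_pos by (auto simp: is_allocation_def mem_rect)
      have "0 \<le> c x y" "a x y - a x y * c x y \<le> a 0 y"
        using adm c xy by (auto simp: admissible_def is_allocation_def)
      \<comment> \<open>As \<open>a x y \<le> 1\<close>, the product \<open>a x y * c x y\<close> is
        at most \<open>c x y\<close>: a linear consequence of the non-convex constraint.\<close>
      then show ac: "a x y - a 0 y \<le> c x y"
        using * mult_right_mono[of "a x y" 1 "c x y"] by simp
      have "D * (a x y - a 0 y) \<le> D * c x y"
        using ac D_nonneg by (rule mult_left_mono)
      also have "\<dots> \<le> lam * K * c x y"
        using lamK \<open>0 \<le> c x y\<close> by (rule mult_right_mono)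
      finally show "D * (a x y - a 0 y) \<le> lam * K * c x y" .
      show "net_loss x v * a 0 y \<le> net_loss x v * a x y"
        using *(3) net_loss_at_v_nonneg by (rule mult_left_mono)
    qed
    have q_meas: "(\<lambda>(x, y). a 0 y) \<in> borel_measurable joint"
      by (rule common_section_measurable[OF a])
    have q_bound: "0 \<le> a 0 y" "a 0 y \<le> 1" if "y \<in> {0..ubar}" for y
      using pointwise(1,2)[of 0 y] that A.b_pos by (auto simp: mem_rect)
    \<comment> \<open>Weights in \<open>u\<close> alone: what \<alpha> = 0 is denied below
      \<open>v\<close>, and what it is given above \<open>v\<close>. Their centred terms integrate
      to zero.\<close>
    define lo where "lo y = (if y \<le> v then 1 - a 0 y else 0)" for y
    define hi where "hi y = (if v < y then a 0 y else 0)" for y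
    have lo_meas: "(\<lambda>(x, y). lo y) \<in> borel_measurable joint"
      and hi_meas: "(\<lambda>(x, y). hi y) \<in> borel_measurable joint"
      using q_meas unfolding lo_def hi_def split_beta' by measurable
    have lo_bound: "0 \<le> lo y \<and> lo y \<le> 1" and hi_bound: "0 \<le> hi y \<and> hi y \<le> 1"
      if "y \<in> {0..ubar}" for y
      using q_bound[OF that] by (auto simp: lo_def hi_def)

    have "0 = (\<integral>z. (D - net_loss (fst z) v) * lo (snd z) \<partial>joint)"
      using lo_bound by (subst net_loss_centred[OF lo_meas, of 1]) auto
    also have "\<dots> \<le> lagrangian ?p ?z - lagrangian ?aT ?cT"
      unfolding lagrangian_diff(1)[OF p aT z cT]
    proof (intro integral_mono integrable_centred lo_meas lo_bound lagrangian_diff(2)[OF p aT z cT])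
      fix z assume "z \<in> space joint"
      then obtain x y where xy: "z = (x, y)" "(x, y) \<in> rect"
        by (cases z) auto
      show "(D - net_loss (fst z) v) * lo (snd z) \<le>
         net_loss (fst z) (snd z) * ?aT (fst z) (snd z) - net_loss (fst z) (snd z) * ?p (fst z) (snd z)
        + D / r v * (r (snd z) * ?p (fst z) (snd z) - r (snd z) * ?aT (fst z) (snd z))
        + D / r v * K * (?cT (fst z) (snd z) - 0)"
      proof (cases "y \<le> v")
        case True
        \<comment> \<open>Split \<open>1 - a 0 y\<close> into \<open>1 - a x y\<close>, which yields
          virtual surplus at least \<open>r v\<close> per unit, and \<open>a x y - a 0 y\<close>,
          which is covered by the saved inspections.\<close>
        have "net_loss x y * (1 - a x y) \<le> net_loss x v * (1 - a x y)"
          using net_loss_below[of x y] pointwise(2)[OF xy(2)] xy True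
          by (intro mult_right_mono) (auto simp: mem_rect)
        moreover have "D * (1 - a x y) \<le> lam * r y * (1 - a x y)"
          using mult_left_mono[OF r_mono[of y v] lam(1)] lam(2) pointwise(2)[OF xy(2)] xy True v_less
          by (intro mult_right_mono) (auto simp: mem_rect)
        ultimately show ?thesis
          using pointwise(6,7)[OF xy(2)] True
          by (simp add: xy(1) lo_def mix_a_def mix_c_def posted_def lam_def[symmetric] algebra_simps)
      qed (simp add: xy(1) lo_def mix_a_def mix_c_def posted_def)
    qed auto
    finally have posted_ge: "lagrangian ?aT ?cT \<le> lagrangian ?p ?z"
      by simp

    \<comment> \<open>The excess of the loss over its value at \<open>v\<close>; it is strictly
      positive above \<open>v\<close> and bounds from below what truncation adds to the
      Lagrangian.\<close>
    define \<psi> where "\<psi> z = net_loss (fst z) (snd z) - net_loss (fst z) v" for z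
    have \<psi>_meas: "\<psi> \<in> borel_measurable joint"
    proof (rule joint_measurable)
      show "\<psi> \<in> borel_measurable (borel \<Otimes>\<^sub>M borel)"
        unfolding \<psi>_def[abs_def]
        by (intro borel_measurable_diff net_loss_measurable measurable_compose[OF measurable_fst])
    qed
    have \<psi>_bound: "\<bar>\<psi> (x, y)\<bar> \<le> 2 * ubar" if "(x, y) \<in> rect" for x y
      using net_loss_bound[OF that] net_loss_bound[of x v] that v_pos v_less
      by (auto simp: \<psi>_def mem_rect)
    let ?Y = "\<lambda>z. (if v < snd z then \<psi> z else 0) * a (fst z) (snd z)"
    have int_Y: "integrable joint ?Y"
      using \<psi>_meas \<psi>_bound U.b_pos
      by (intro integrable_times_allocation[OF a, where C = "2 * ubar"]) auto
    have int_hi: "integrable joint (\<lambda>z. (D - net_loss (fst z) v) * hi (snd z))"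
      by (intro integrable_centred hi_meas hi_bound)
    have "(\<integral>z. ?Y z \<partial>joint) = (\<integral>z. ?Y z - (D - net_loss (fst z) v) * hi (snd z) \<partial>joint)"
      using int_Y int_hi net_loss_centred[OF hi_meas, of 1] hi_bound by simp
    also have "\<dots> \<le> lagrangian ?aT ?cT - lagrangian a c"
      unfolding lagrangian_diff(1)[OF aT a cT c]
    proof (intro integral_mono Bochner_Integration.integrable_diff int_Y int_hi lagrangian_diff(2)[OF aT a cT c])
      fix z assume "z \<in> space joint"
      then obtain x y where xy: "z = (x, y)" "(x, y) \<in> rect"
        by (cases z) auto
      show "?Y z - (D - net_loss (fst z) v) * hi (snd z) \<le>
         net_loss (fst z) (snd z) * a (fst z) (snd z) - net_loss (fst z) (snd z) * ?aT (fst z) (snd z)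
        + D / r v * (r (snd z) * ?aT (fst z) (snd z) - r (snd z) * a (fst z) (snd z))
        + D / r v * K * (c (fst z) (snd z) - ?cT (fst z) (snd z))"
      proof (cases "v < y")
        case True
        \<comment> \<open>Above \<open>v\<close> the priced virtual surplus is at most
          \<open>D\<close> per unit; the part \<open>a x y - a 0 y\<close> of that is offset by
          inspection cost.\<close>
        have "lam * r y * a x y \<le> D * a x y"
          using mult_left_mono[OF r_mono[of v y] lam(1)] lam(2) pointwise(1)[OF xy(2)] xy True v_pos
          by (intro mult_right_mono) (auto simp: mem_rect)
        then show ?thesis
          using pointwise(6,7)[OF xy(2)] True
          by (simp add: xy(1) hi_def \<psi>_def mix_a_def mix_c_def lam_def[symmetric] algebra_simps)
      qed (simp add: xy(1) hi_def mix_a_def mix_c_def)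
    qed
    finally have truncated_ge: "(\<integral>z. ?Y z \<partial>joint) \<le> lagrangian ?aT ?cT - lagrangian a c" .

    define Bp where "Bp = budget ?p ?z"
    define B0 where "B0 = budget ?aT ?cT"
    \<comment> \<open>The weight that makes the budget of the mixture exactly zero; it lies in
      \<open>{0..1}\<close> because \<open>B0 < 0 \<le> Bp\<close>.\<close>
    define \<theta> where "\<theta> = - B0 / (Bp - B0)"
    have "0 \<le> Bp"
    proof -
      have "0 \<le> (\<integral>z. r (snd z) * ?p (fst z) (snd z) \<partial>joint)"
      proof (intro integral_nonneg_AE AE_I2)
        fix z assume "z \<in> space joint"
        then show "0 \<le> r (snd z) * ?p (fst z) (snd z)"
          using r_mono[of "snd z" v] rho v_less
          by (cases z) (auto simp: posted_def mem_rect)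
      qed
      then show ?thesis
        by (simp add: Bp_def budget_def)
    qed
    moreover have B0: "B0 < 0"
      using False by (simp add: B0_def)
    ultimately have "0 \<le> - B0" and pos: "0 < Bp - B0" and "- B0 \<le> 1 * (Bp - B0)"
      by simp_all
    then have \<theta>: "0 \<le> \<theta>" "\<theta> \<le> 1"
      unfolding \<theta>_def by (simp_all only: divide_nonneg_pos pos_divide_le_eq[OF pos])
    have "\<theta> * (Bp - B0) = - B0"
      using B0 \<open>0 \<le> Bp\<close> by (simp add: \<theta>_def)
    then have balanced: "(1 - \<theta>) * B0 + \<theta> * Bp = 0"
      by (simp add: algebra_simps)
    have "loss a \<le> loss (mix_a \<theta> a)"
      using \<theta> balanced by (intro opt) (simp_all only: budget_mix[OF a c, of \<theta>] B0_def Bp_def order_refl)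
    then have "loss a \<le> (1 - \<theta>) * loss ?aT + \<theta> * loss ?p"
      by (subst (asm) loss_mix[OF a c])
    \<comment> \<open>The budget terms inside the Lagrangians cancel against the last summand, which
      is zero by the choice of \<theta>.\<close>
    also have "\<dots> = - ((1 - \<theta>) * lagrangian ?aT ?cT + \<theta> * lagrangian ?p ?z)
        + lam * ((1 - \<theta>) * B0 + \<theta> * Bp)"
      by (simp add: lagrangian_eq B0_def Bp_def algebra_simps)
    also have "\<dots> = - ((1 - \<theta>) * lagrangian ?aT ?cT + \<theta> * lagrangian ?p ?z)"
      unfolding balanced by simp
    also have "\<dots> \<le> - lagrangian ?aT ?cT"
      using mult_left_mono[OF posted_ge \<theta>(1)] by (simp add: algebra_simps)
    finally have "lagrangian ?aT ?cT \<le> - loss a"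
      by simp
    \<comment> \<open>The slack of \<open>(a, c)\<close> is nonnegative, so its Lagrangian is at
      least its welfare. Truncation therefore gains nothing, and the integral of \<open>?Y\<close>
      cannot be positive.\<close>
    also have "\<dots> \<le> lagrangian a c"
      using bud lam(1) by (simp add: lagrangian_eq)
    finally have "(\<integral>z. ?Y z \<partial>joint) \<le> 0"
      using truncated_ge by simp
    then show ?thesis
      using net_loss_above
      by (intro vanishes_above[OF a \<psi>_meas \<psi>_bound]) (auto simp: \<psi>_def mem_rect)
  qed
qed

text \<open>When \<open>t \<alpha> u = \<alpha> * u\<close> and \<open>abar \<le> 1\<close>, \<open>K_low\<close> is \<open>0 / 0 = 0\<close> and says nothing about \<open>r v\<close>; but then
  no type is worth serving.\<close>

lemma nonneg_welfare_vanishes_above: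
  assumes a: "is_allocation a" and "t = (\<lambda>\<alpha> u. \<alpha> * u)" "abar \<le> 1" and le: "loss a \<le> 0"
  shows "AE z in joint. v < snd z \<longrightarrow> a (fst z) (snd z) = 0"
proof -
  \<comment> \<open>As \<alpha> never exceeds 1, each served type has nonnegative loss. With total
    loss at most 0, the part above \<open>v\<close> is left with a nonpositive loss.\<close>
  have "0 \<le> loss (mix_a 0 a)"
    unfolding loss_def
  proof (intro integral_nonneg_AE AE_I2)
    fix z assume "z \<in> space joint"
    then obtain x y where xy: "z = (x, y)" "(x, y) \<in> rect"
      by (cases z) auto
    have "t x y = x * y"
      using assms(2) by simp
    then have "0 \<le> net_loss x y"
      using \<open>abar \<le> 1\<close> xy mult_right_mono[of x 1 y] by (auto simp: net_loss_def mem_rect min_def)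
    then show "0 \<le> net_loss (fst z) (snd z) * mix_a 0 a (fst z) (snd z)"
      using a xy by (auto simp: mix_a_def is_allocation_def)
  qed
  then show ?thesis
    using net_loss_above net_loss_at_v_nonneg net_loss_bound loss_diff_above[OF a] le
    by (intro vanishes_above[OF a, where \<psi> = "\<lambda>z. net_loss (fst z) (snd z)" and C = ubar])
       (auto simp: mem_rect intro: joint_measurable le_less_trans)
qed

text \<open>If \<open>r v \<le> K\<close> the Lagrangian argument applies; otherwise
  \<open>K_low < K < r v\<close>, which by \<open>K_low_ge\<close> leaves only the degenerate
  case.\<close>

lemma optimal_no_allocation:
  assumes opt: "optimal abar ubar f g t v K a c"
  shows "AE z in joint. v < snd z \<longrightarrow> a (fst z) (snd z) = 0"
proof -
  have adm: "admissible a c" and bud: "0 \<le> budget a c"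
    using opt by (auto simp: optimal_def feasible_iff)
  then have a: "is_allocation a" by (simp add: admissible_def)
  have better: "loss a \<le> loss a'" if "admissible a' c'" "0 \<le> budget a' c'" for a' c'
  proof -
    have "welfare abar ubar f g t v a' \<le> welfare abar ubar f g t v a"
      using opt that by (auto simp: optimal_def feasible_iff)
    then show ?thesis
      using that a by (simp add: welfare_eq loss_def admissible_def)
  qed
  show ?thesis
  proof (cases "r v \<le> K")
    case True
    then show ?thesis
      using adm bud by (rule_tac optimal_vanishes_above) (auto intro: better admissible_mix)
  next
    case False
    then have "t = (\<lambda>\<alpha> u. \<alpha> * u) \<and> abar \<le> 1"
      using K_low_ge[OF t v_pos v_less] K_gt by auto
    \<comment> \<open>Serving nobody is always feasible, so an optimal solution has nonnegative
      welfare.\<close>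
    moreover have "loss a \<le> loss (\<lambda>x y. 0)"
      using is_allocation_zero
      by (intro better[of "\<lambda>x y. 0" "\<lambda>x y. 0"]) (auto simp: admissible_def budget_def)
    then have "loss a \<le> 0"
      by (simp add: loss_def)
    ultimately show ?thesis
      using a by (intro nonneg_welfare_vanishes_above) simp_all
  qed
qed

end

section \<open>From almost every to every \<open>u\<close> above \<open>v\<close>\<close>

theorem lemma3:
  fixes abar ubar v K :: real
    and f g :: "real \<Rightarrow> real"
    and t a c :: "real \<Rightarrow> real \<Rightarrow> real"
  assumes "0 < abar" and "0 < ubar" and "0 < v"
    and "type_density abar f" and "type_density ubar g"
    and "t = (\<lambda>\<alpha> u. \<alpha>) \<or> t = (\<lambda>\<alpha> u. \<alpha> * u)"
    and "K > K_low f g t v"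
    and "antimono_on {0..ubar} (virtual_surplus g)"
    and "optimal abar ubar f g t v K a c"
  shows "AE \<alpha> in lborel. 0 < \<alpha> \<and> \<alpha> \<le> abar \<longrightarrow>
           (\<forall>u. v < u \<and> u \<le> ubar \<longrightarrow> a \<alpha> u = 0 \<and> c \<alpha> u = 0)"
proof (cases "v < ubar")
  case False
  then show ?thesis by (auto intro!: AE_I2)
next
  case True
  interpret regulator abar ubar f g t v K
    using assms True by unfold_locales auto
  have adm: "admissible a c"
    using assms by (auto simp: optimal_def feasible_iff)
  from AE_joint_imp[OF optimal_no_allocation[OF assms(9)]]
  show ?thesis
  proof (rule eventually_mono, intro impI allI)
    fix \<alpha> u
    assume AE: "\<alpha> \<in> {0..abar} \<longrightarrow> (AE y in lborel. v < y \<and> y \<in> {0..ubar} \<longrightarrow> a \<alpha> y = 0)"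
      and \<alpha>: "0 < \<alpha> \<and> \<alpha> \<le> abar" and u: "v < u \<and> u \<le> ubar"
    \<comment> \<open>A zero of \<open>a \<alpha>\<close> strictly between \<open>v\<close> and
      \<open>u\<close> forces \<open>a \<alpha> u = 0\<close> by monotonicity, and then
      \<open>c \<le> a\<close> removes the inspection. So only \<alpha> keeps an exceptional null
      set.\<close>
    have "AE y in lborel. v < y \<and> y < u \<longrightarrow> a \<alpha> y = 0"
      using AE \<alpha> u v_pos by (auto elim!: eventually_mono)
    then obtain y where y: "v < y" "y < u" "a \<alpha> y = 0"
      using u by (rule_tac AE_interval_witness[of v u "\<lambda>y. a \<alpha> y = 0"]) auto
    have "(\<alpha>, u) \<in> rect"
      using \<alpha> u v_pos by (auto simp: mem_rect)
    moreover have "0 \<le> y" "y \<le> u"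
      using y v_pos by auto
    ultimately have "0 \<le> a \<alpha> u" "0 \<le> c \<alpha> u" "c \<alpha> u \<le> a \<alpha> u" "a \<alpha> u \<le> a \<alpha> y"
      using adm unfolding admissible_def is_allocation_def by blast+
    with y show "a \<alpha> u = 0 \<and> c \<alpha> u = 0"
      by simp
  qed
qed

end
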